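(* Let $R\subset S$ be an integral FCP extension of commutative rings. If ${}_S^uR\subseteq S$ is catenarian, where ${}_S^uR$ is the u-closure of $R$ in $S$, then the co-subintegral closure of $R\subset S$ exists. In particular, these conditions hold if $R\subset S$ is catenarian.
   Context: All rings are commutative and unital; $\subset$ denotes proper inclusion. $[R,S]$ is the set of all $R$-subalgebras of $S$, ordered by inclusion; $R\subseteq S$ has FCP if each chain in $[R,S]$ is finite. An FCP extension $T\subseteq S$ is catenarian if all maximal chains of $[T,S]$ have the same length. $R\subseteq S$ is u-closed (anodal) if $b\in S$ lies in $R$ whenever $b^2-b\in R$ and $b^3-b^2\in R$; the u-closure ${}_S^uR$ is the smallest $B\in[R,S]$ such that $B\subseteq S$ is u-closed. An integral extension $U\subseteq S$ is subintegral if $\mathrm{Spec}(S)\to\mathrm{Spec}(U)$ is injective and all the residual field extensions $\kappa_U(Q\cap U)\to\kappa_S(Q)$ ($Q\in\mathrm{Spec}(S)$) are isomorphisms. The co-subintegral closure of $R\subseteq S$, if it exists, is the least $V\in[R,S]$ such that $V\subseteq S$ is subintegral. *)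

theory Defs
  imports "HOL-Algebra.Algebra"
begin

text \<open>An extension of rings is given by the big ring \<open>S\<close> and a subset \<open>R\<close> of its carrier;
  the small ring itself is \<open>S\<lparr>carrier := R\<rparr>\<close>.\<close>

definition ring_extension :: "'a set \<Rightarrow> ('a, 'b) ring_scheme \<Rightarrow> bool" where
  "ring_extension R S \<longleftrightarrow> cring S \<and> subring R S"

definition intermediate_rings :: "'a set \<Rightarrow> ('a, 'b) ring_scheme \<Rightarrow> 'a set set" where
  "intermediate_rings R S = {T. subring T S \<and> R \<subseteq> T}"

definition FCP :: "'a set \<Rightarrow> ('a, 'b) ring_scheme \<Rightarrow> bool" where
  "FCP R S \<longleftrightarrow> ring_extension R S \<and>
     (\<forall>C. subset.chain (intermediate_rings R S) C \<longrightarrow> finite C)"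

definition chain_length :: "'a set set \<Rightarrow> nat" where
  "chain_length C = card C - 1"

definition catenarian :: "'a set \<Rightarrow> ('a, 'b) ring_scheme \<Rightarrow> bool" where
  "catenarian R S \<longleftrightarrow> FCP R S \<and>
     (\<forall>C D. subset.maxchain (intermediate_rings R S) C \<and> subset.maxchain (intermediate_rings R S) D
        \<longrightarrow> chain_length C = chain_length D)"

text \<open>Polynomials are coefficient lists with the leading coefficient first.\<close>

definition integral_over :: "'a set \<Rightarrow> ('a, 'b) ring_scheme \<Rightarrow> 'a \<Rightarrow> bool" where
  "integral_over R S x \<longleftrightarrow>
     (\<exists>p. p \<noteq> [] \<and> set p \<subseteq> R \<and> lead_coeff p = \<one>\<^bsub>S\<^esub> \<and> ring.eval S p x = \<zero>\<^bsub>S\<^esub>)"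

definition integral_extension :: "'a set \<Rightarrow> ('a, 'b) ring_scheme \<Rightarrow> bool" where
  "integral_extension R S \<longleftrightarrow> ring_extension R S \<and> (\<forall>x \<in> carrier S. integral_over R S x)"

definition u_closed :: "'a set \<Rightarrow> ('a, 'b) ring_scheme \<Rightarrow> bool" where
  "u_closed R S \<longleftrightarrow> ring_extension R S \<and>
     (\<forall>b \<in> carrier S.
        b [^]\<^bsub>S\<^esub> (2::nat) \<ominus>\<^bsub>S\<^esub> b \<in> R \<and>
        b [^]\<^bsub>S\<^esub> (3::nat) \<ominus>\<^bsub>S\<^esub> b [^]\<^bsub>S\<^esub> (2::nat) \<in> R \<longrightarrow> b \<in> R)"

definition u_closure :: "'a set \<Rightarrow> ('a, 'b) ring_scheme \<Rightarrow> 'a set" where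
  "u_closure R S = (LEAST B. B \<in> intermediate_rings R S \<and> u_closed B S)"

text \<open>The least element exists, so \<^const>\<open>u_closure\<close> is meaningful.\<close>

lemma u_closure_eq_Inter:
  assumes ext: "ring_extension R S"
  shows "u_closure R S = \<Inter>{B \<in> intermediate_rings R S. u_closed B S}"
    and "u_closure R S \<in> intermediate_rings R S"
    and "u_closed (u_closure R S) S"
proof -
  let ?F = "{B \<in> intermediate_rings R S. u_closed B S}"
  interpret cring S using ext by (simp add: ring_extension_def)
  have "carrier S \<in> ?F"
    using ext carrier_is_subring subringE(1)[of R S]
    by (simp add: intermediate_rings_def u_closed_def ring_extension_def)
  moreover have "subring B S" if "B \<in> ?F" for B
    using that by (simp add: intermediate_rings_def)
  ultimately have sub: "subring (\<Inter>?F) S"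
    by (intro subring_Inter) blast+
  moreover have "R \<subseteq> \<Inter>?F"
    unfolding intermediate_rings_def by blast
  ultimately have I: "\<Inter>?F \<in> intermediate_rings R S"
    unfolding intermediate_rings_def by blast
  have U: "u_closed (\<Inter>?F) S"
  proof (rule u_closed_def[THEN iffD2], intro conjI ballI impI InterI)
    show "ring_extension (\<Inter>?F) S"
      using sub is_cring by (simp add: ring_extension_def)
  next
    fix b B
    assume b: "b \<in> carrier S"
      "b [^]\<^bsub>S\<^esub> (2::nat) \<ominus>\<^bsub>S\<^esub> b \<in> \<Inter>?F \<and>
       b [^]\<^bsub>S\<^esub> (3::nat) \<ominus>\<^bsub>S\<^esub> b [^]\<^bsub>S\<^esub> (2::nat) \<in> \<Inter>?F" and B: "B \<in> ?F"
    then have "u_closed B S" by blast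
    then show "b \<in> B" using b B unfolding u_closed_def by blast
  qed
  show *: "u_closure R S = \<Inter>?F"
    unfolding u_closure_def using I U by (intro Least_equality) blast+
  show "u_closure R S \<in> intermediate_rings R S" "u_closed (u_closure R S) S"
    using I U * by simp_all
qed

text \<open>\<open>fraction D a s\<close> is the class of all pairs representing the fraction \<open>a / s\<close>.\<close>

definition fraction :: "('a, 'b) ring_scheme \<Rightarrow> 'a \<Rightarrow> 'a \<Rightarrow> ('a \<times> 'a) set" where
  "fraction D a s =
     {(b, t). b \<in> carrier D \<and> t \<in> carrier D - {\<zero>\<^bsub>D\<^esub>} \<and> a \<otimes>\<^bsub>D\<^esub> t = b \<otimes>\<^bsub>D\<^esub> s}"

text \<open>As with the multiplication of cosets in a quotient ring, each union below is over
  sets that all coincide.\<close>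

definition fraction_field :: "('a, 'b) ring_scheme \<Rightarrow> ('a \<times> 'a) set ring" where
  "fraction_field D =
     \<lparr> carrier = {fraction D a s | a s. a \<in> carrier D \<and> s \<in> carrier D - {\<zero>\<^bsub>D\<^esub>}},
       monoid.mult = (\<lambda>F G. \<Union>(a, s)\<in>F. \<Union>(b, t)\<in>G. fraction D (a \<otimes>\<^bsub>D\<^esub> b) (s \<otimes>\<^bsub>D\<^esub> t)),
       one = fraction D \<one>\<^bsub>D\<^esub> \<one>\<^bsub>D\<^esub>,
       ring.zero = fraction D \<zero>\<^bsub>D\<^esub> \<one>\<^bsub>D\<^esub>,
       ring.add = (\<lambda>F G. \<Union>(a, s)\<in>F. \<Union>(b, t)\<in>G.
                fraction D (a \<otimes>\<^bsub>D\<^esub> t \<oplus>\<^bsub>D\<^esub> b \<otimes>\<^bsub>D\<^esub> s) (s \<otimes>\<^bsub>D\<^esub> t)) \<rparr>"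

definition residue_field :: "('a, 'b) ring_scheme \<Rightarrow> 'a set \<Rightarrow> ('a set \<times> 'a set) set ring" where
  "residue_field A P = fraction_field (A Quot P)"

text \<open>The maps \<open>U/(Q \<inter> U) \<rightarrow> S/Q\<close> and \<open>\<kappa>\<^sub>U(Q \<inter> U) \<rightarrow> \<kappa>\<^sub>S(Q)\<close> induced by an inclusion
  \<open>U \<subseteq> S\<close>.\<close>

definition quotient_map :: "('a, 'b) ring_scheme \<Rightarrow> 'a set \<Rightarrow> 'a set \<Rightarrow> 'a set" where
  "quotient_map S Q A = (\<Union>x\<in>A. Q +>\<^bsub>S\<^esub> x)"

definition residue_map ::
    "('a, 'b) ring_scheme \<Rightarrow> 'a set \<Rightarrow> ('a set \<times> 'a set) set \<Rightarrow> ('a set \<times> 'a set) set" where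
  "residue_map S Q F =
     (\<Union>(A, B)\<in>F. fraction (S Quot Q) (quotient_map S Q A) (quotient_map S Q B))"

definition subintegral :: "'a set \<Rightarrow> ('a, 'b) ring_scheme \<Rightarrow> bool" where
  "subintegral U S \<longleftrightarrow> integral_extension U S \<and>
     inj_on (\<lambda>Q. Q \<inter> U) {Q. primeideal Q S} \<and>
     (\<forall>Q. primeideal Q S \<longrightarrow>
        residue_map S Q \<in>
          ring_iso (residue_field (S\<lparr>carrier := U\<rparr>) (Q \<inter> U)) (residue_field S Q))"

definition is_co_subintegral_closure :: "'a set \<Rightarrow> ('a, 'b) ring_scheme \<Rightarrow> 'a set \<Rightarrow> bool" where
  "is_co_subintegral_closure R S V \<longleftrightarrow>
     V \<in> intermediate_rings R S \<and> subintegral V S \<and>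
     (\<forall>W \<in> intermediate_rings R S. subintegral W S \<longrightarrow> V \<subseteq> W)"

end

theory Submission
  imports Defs
begin

text \<open>If \<open>W \<subseteq> S\<close> is subintegral, then \<open>Spec S \<rightarrow> Spec W\<close> is injective. Hence \<open>W\<close> is u-closed in \<open>S\<close>: if
  \<open>b\<^sup>2 - b, b\<^sup>3 - b\<^sup>2 \<in> W\<close> but \<open>b \<notin> W\<close>, then some prime of \<open>W\<close> lies below a prime containing \<open>b\<close> and below one
  containing \<open>1 - b\<close>. So \<open>W\<close> contains the u-closure of \<open>R\<close>. Conversely, for integral FCP extensions
  u-closedness gives injectivity on spectra, because modulo the conductor every element has a power
  that is associated to an idempotent. By FCP it therefore suffices that the intersection \<open>V\<close> of two subintegral
  subextensions \<open>W\<^sub>1\<close>, \<open>W\<^sub>2\<close> has the same residue field as \<open>S\<close> at each prime \<open>Q\<close> of \<open>S\<close>. If the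
  conductor of \<open>V\<close> in \<open>S\<close> is not contained in \<open>Q\<close> this is clear. Otherwise the same happens for the
  conductor of some \<open>W\<^sub>i\<close>, and above \<open>W\<^sub>i\<close> there is a minimal extension \<open>A \<subset> B\<close> with conductor
  \<open>M = Q \<inter> A\<close>, where \<open>A\<close> already has the residue field of \<open>S\<close>. It is ramified: \<open>B = A[x]\<close> with
  \<open>x\<^sup>2 \<in> M\<close>. If \<open>V\<close> had a smaller residue field, then \<open>T = V + M \<subset> A\<close>, and the interval from \<open>T\<close>
  to \<open>B\<close> would have maximal chains of different lengths, contradicting catenarity.\<close>

section \<open>Submodules over a subring\<close>

lemma (in ring) mem_set_add_iff: "x \<in> A <+>\<^bsub>R\<^esub> B \<longleftrightarrow> (\<exists>a\<in>A. \<exists>b\<in>B. x = a \<oplus> b)"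
  by (auto simp: set_add_def')

lemma (in cring) primeideal_iff:
  "primeideal P R \<longleftrightarrow>
     ideal P R \<and> \<one> \<notin> P \<and> (\<forall>a\<in>carrier R. \<forall>b\<in>carrier R. a \<otimes> b \<in> P \<longrightarrow> a \<in> P \<or> b \<in> P)"
proof
  assume "primeideal P R"
  then interpret P: primeideal P R .
  show "ideal P R \<and> \<one> \<notin> P \<and> (\<forall>a\<in>carrier R. \<forall>b\<in>carrier R. a \<otimes> b \<in> P \<longrightarrow> a \<in> P \<or> b \<in> P)"
    using P.is_ideal P.one_imp_carrier P.I_notcarr P.I_prime by blast
qed (auto intro: primeidealI is_cring)

lemma (in cring) maximalideal_iff:
  "maximalideal M R \<longleftrightarrow>
     ideal M R \<and> \<one> \<notin> M \<and> (\<forall>J. ideal J R \<longrightarrow> M \<subseteq> J \<longrightarrow> \<one> \<notin> J \<longrightarrow> J = M)"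
proof
  assume "maximalideal M R"
  then interpret M: maximalideal M R .
  show "ideal M R \<and> \<one> \<notin> M \<and> (\<forall>J. ideal J R \<longrightarrow> M \<subseteq> J \<longrightarrow> \<one> \<notin> J \<longrightarrow> J = M)"
    using M.is_ideal M.one_imp_carrier M.I_notcarr M.I_maximal
      additive_subgroup.a_subset[OF ideal.axioms(1)] by blast
next
  assume M: "ideal M R \<and> \<one> \<notin> M \<and> (\<forall>J. ideal J R \<longrightarrow> M \<subseteq> J \<longrightarrow> \<one> \<notin> J \<longrightarrow> J = M)"
  then show "maximalideal M R"
    using ideal.one_imp_carrier by (intro maximalidealI) blast+
qed

context cring
begin

lemma subring_is_cring:
  assumes "subring T R"
  shows "cring (R\<lparr>carrier := T\<rparr>)"
  using subcring_iff[OF subringE(1)[OF assms]] subcringI'[OF assms] by blast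

lemma subring_minus_closed:
  assumes "subring T R" "a \<in> T" "b \<in> T"
  shows "a \<ominus> b \<in> T"
  using subringE(5,7)[OF assms(1)] assms(2,3) by (simp add: minus_eq)

lemma subring_nat_pow_closed:
  assumes "subring T R" "a \<in> T"
  shows "a [^] (n::nat) \<in> T"
  using subringE(3,6)[OF assms(1)] assms(2) by (induction n) simp_all

definition submodule_over :: "'a set \<Rightarrow> 'a set \<Rightarrow> bool" where
  "submodule_over T M \<longleftrightarrow> additive_subgroup M R \<and> (\<forall>t\<in>T. \<forall>m\<in>M. t \<otimes> m \<in> M)"

lemma submodule_overE:
  assumes "submodule_over T M"
  shows "M \<subseteq> carrier R" and "\<zero> \<in> M"
    and "\<And>a b. a \<in> M \<Longrightarrow> b \<in> M \<Longrightarrow> a \<oplus> b \<in> M"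
    and "\<And>t m. t \<in> T \<Longrightarrow> m \<in> M \<Longrightarrow> t \<otimes> m \<in> M"
    and "\<And>a. a \<in> M \<Longrightarrow> \<ominus> a \<in> M"
    and "\<And>a b. a \<in> M \<Longrightarrow> b \<in> M \<Longrightarrow> a \<ominus> b \<in> M"
proof -
  interpret M: additive_subgroup M R using assms unfolding submodule_over_def by blast
  show "M \<subseteq> carrier R" "\<zero> \<in> M" "\<And>a b. a \<in> M \<Longrightarrow> b \<in> M \<Longrightarrow> a \<oplus> b \<in> M"
    using M.a_subset by auto
  show "\<And>t m. t \<in> T \<Longrightarrow> m \<in> M \<Longrightarrow> t \<otimes> m \<in> M" using assms unfolding submodule_over_def by blast
  show neg: "\<ominus> a \<in> M" if "a \<in> M" for a
    using M.a_inv_closed[OF that] .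
  show "a \<ominus> b \<in> M" if "a \<in> M" "b \<in> M" for a b
    using M.a_closed[OF that(1) neg[OF that(2)]] by (simp add: minus_eq)
qed

lemma submodule_overI:
  assumes T: "subring T R" and M: "M \<subseteq> carrier R" "\<zero> \<in> M"
    and add: "\<And>a b. a \<in> M \<Longrightarrow> b \<in> M \<Longrightarrow> a \<oplus> b \<in> M"
    and smult: "\<And>t m. t \<in> T \<Longrightarrow> m \<in> M \<Longrightarrow> t \<otimes> m \<in> M"
  shows "submodule_over T M"
proof -
  have "\<ominus> m \<in> M" if "m \<in> M" for m
  proof -
    have "\<ominus> m = (\<ominus> \<one>) \<otimes> m" using that M(1) by (simp add: l_minus subset_iff)
    then show ?thesis using smult[OF subringE(5)[OF T subringE(3)[OF T]] that] by simp
  qed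
  then have "subgroup M (add_monoid R)"
    using M add by (intro add.subgroupI) auto
  then show ?thesis unfolding submodule_over_def additive_subgroup_def using smult by blast
qed

lemma submodule_over_mono: "submodule_over T M \<Longrightarrow> T' \<subseteq> T \<Longrightarrow> submodule_over T' M"
  unfolding submodule_over_def by blast

lemma submodule_over_add_iff:
  assumes M: "submodule_over T M" and b: "b \<in> M" and a: "a \<in> carrier R"
  shows "a \<oplus> b \<in> M \<longleftrightarrow> a \<in> M" and "a \<ominus> b \<in> M \<longleftrightarrow> a \<in> M"
proof -
  note M' = submodule_overE[OF M]
  have "b \<in> carrier R" using M'(1) b by blast
  then have "(a \<oplus> b) \<ominus> b = a" "(a \<ominus> b) \<oplus> b = a" using a by algebra+
  then show "a \<oplus> b \<in> M \<longleftrightarrow> a \<in> M" "a \<ominus> b \<in> M \<longleftrightarrow> a \<in> M"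
    using M'(3,6) b by metis+
qed

lemma submodule_over_Int:
  assumes "submodule_over T M" "submodule_over T N"
  shows "submodule_over T (M \<inter> N)"
  using assms add.subgroups_Inter_pair unfolding submodule_over_def additive_subgroup_def by blast

lemma submodule_over_subring:
  assumes "subring A R" "T \<subseteq> A"
  shows "submodule_over T A"
  unfolding submodule_over_def additive_subgroup_def
  using subring.axioms(1)[OF assms(1)] subringE(6)[OF assms(1)] assms(2) by (simp add: subset_iff)

lemma ideal_of_subring_iff:
  assumes T: "subring T R"
  shows "ideal I (R\<lparr>carrier := T\<rparr>) \<longleftrightarrow> I \<subseteq> T \<and> submodule_over T I"
proof
  have TR: "T \<subseteq> carrier R" using subringE(1)[OF T] .
  assume "ideal I (R\<lparr>carrier := T\<rparr>)"
  then interpret I: ideal I "R\<lparr>carrier := T\<rparr>" .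
  show "I \<subseteq> T \<and> submodule_over T I"
  proof
    note I' = additive_subgroup.zero_closed[OF I.is_additive_subgroup]
      additive_subgroup.a_closed[OF I.is_additive_subgroup]
    show "I \<subseteq> T" using I.a_subset by simp
    then show "submodule_over T I"
      using TR I' I.I_l_closed by (intro submodule_overI[OF T]) auto
  qed
next
  interpret T: cring "R\<lparr>carrier := T\<rparr>" by (rule subring_is_cring[OF T])
  assume I: "I \<subseteq> T \<and> submodule_over T I"
  then have "T.submodule_over T I"
    using submodule_overE(1-4)[of T I] by (intro T.submodule_overI[OF T.carrier_is_subring[simplified]]) auto
  moreover have "a \<otimes> t \<in> I" if "a \<in> I" "t \<in> T" for a t
    using T.m_comm[of a t] submodule_overE(4)[of T I t a] I that by auto
  ultimately show "ideal I (R\<lparr>carrier := T\<rparr>)"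
    unfolding T.submodule_over_def additive_subgroup_def by (intro idealI T.ring_axioms) auto
qed

lemma ideal_iff_submodule_over: "ideal I R \<longleftrightarrow> submodule_over (carrier R) I"
  using ideal_of_subring_iff[OF carrier_is_subring, of I] submodule_overE(1) by auto

lemmas ideal_imp_submodule_over = iffD1[OF ideal_iff_submodule_over]

lemma primeideal_of_subring_iff:
  assumes T: "subring T R"
  shows "primeideal P (R\<lparr>carrier := T\<rparr>) \<longleftrightarrow>
    ideal P (R\<lparr>carrier := T\<rparr>) \<and> \<one> \<notin> P \<and> (\<forall>a\<in>T. \<forall>b\<in>T. a \<otimes> b \<in> P \<longrightarrow> a \<in> P \<or> b \<in> P)"
  using cring.primeideal_iff[OF subring_is_cring[OF T]] by simp

lemma maximalideal_of_subring_iff: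
  assumes T: "subring T R"
  shows "maximalideal M (R\<lparr>carrier := T\<rparr>) \<longleftrightarrow>
    ideal M (R\<lparr>carrier := T\<rparr>) \<and> \<one> \<notin> M \<and>
    (\<forall>J. ideal J (R\<lparr>carrier := T\<rparr>) \<longrightarrow> M \<subseteq> J \<longrightarrow> \<one> \<notin> J \<longrightarrow> J = M)"
  using cring.maximalideal_iff[OF subring_is_cring[OF T]] by simp

lemma primeideal_of_subring_nat_pow:
  assumes T: "subring T R" and P: "primeideal P (R\<lparr>carrier := T\<rparr>)" and a: "a \<in> T" "a [^] (n::nat) \<in> P"
  shows "a \<in> P"
  using a(2) subring_nat_pow_closed[OF T a(1)] a(1) P
  unfolding primeideal_of_subring_iff[OF T] by (induction n) auto

lemma ideal_contract:
  assumes T: "subring T R" and I: "ideal I R"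
  shows "ideal (I \<inter> T) (R\<lparr>carrier := T\<rparr>)"
  using submodule_over_Int[OF submodule_over_mono submodule_over_subring[OF T]] I subringE(1)[OF T]
  unfolding ideal_of_subring_iff[OF T] ideal_iff_submodule_over by blast

lemma primeideal_contract:
  assumes T: "subring T R" and P: "primeideal P R"
  shows "primeideal (P \<inter> T) (R\<lparr>carrier := T\<rparr>)"
  using P subringE(1)[OF T] ideal_contract[OF T, of P]
  unfolding primeideal_iff primeideal_of_subring_iff[OF T] by blast

lemma submodule_over_set_add:
  assumes T: "subring T R" and M: "submodule_over T M" and N: "submodule_over T N"
  shows "submodule_over T (M <+>\<^bsub>R\<^esub> N)"
  unfolding submodule_over_def
proof (intro conjI ballI)
  show "additive_subgroup (M <+>\<^bsub>R\<^esub> N) R"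
    using M N unfolding submodule_over_def by (intro add_additive_subgroups) blast+
  fix t x assume t: "t \<in> T" and "x \<in> M <+>\<^bsub>R\<^esub> N"
  then obtain m n where x: "x = m \<oplus> n" "m \<in> M" "n \<in> N" unfolding mem_set_add_iff by blast
  then have "t \<otimes> x = t \<otimes> m \<oplus> t \<otimes> n"
    using t subringE(1)[OF T] submodule_overE(1)[OF M] submodule_overE(1)[OF N]
    by (simp add: r_distr subset_iff)
  then show "t \<otimes> x \<in> M <+>\<^bsub>R\<^esub> N"
    unfolding mem_set_add_iff using submodule_overE(4)[OF M t x(2)] submodule_overE(4)[OF N t x(3)] by blast
qed

lemma submodule_over_r_coset:
  assumes T: "subring T R" and K: "submodule_over T K" and x: "x \<in> carrier R"
  shows "submodule_over T (K #> x)"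
proof -
  note K' = submodule_overE[OF K]
  have mem: "y \<in> K #> x \<longleftrightarrow> (\<exists>k\<in>K. y = k \<otimes> x)" for y unfolding r_coset_def by blast
  show ?thesis
  proof (rule submodule_overI[OF T])
    show "K #> x \<subseteq> carrier R" using r_coset_subset_G[OF K'(1) x] .
    have "\<zero> = \<zero> \<otimes> x" using x by simp
    then show "\<zero> \<in> K #> x" unfolding mem using K'(2) by blast
  next
    fix y z assume "y \<in> K #> x" "z \<in> K #> x"
    then obtain k l where kl: "k \<in> K" "l \<in> K" "y = k \<otimes> x" "z = l \<otimes> x" unfolding mem by blast
    then have "y \<oplus> z = (k \<oplus> l) \<otimes> x" using K'(1) x by (simp add: l_distr subset_iff)
    then show "y \<oplus> z \<in> K #> x" unfolding mem using K'(3) kl by blast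
  next
    fix t y assume t: "t \<in> T" and "y \<in> K #> x"
    then obtain k where k: "k \<in> K" "y = k \<otimes> x" unfolding mem by blast
    then have "t \<otimes> y = (t \<otimes> k) \<otimes> x" using t K'(1) subringE(1)[OF T] x by (simp add: m_assoc subset_iff)
    then show "t \<otimes> y \<in> K #> x" unfolding mem using K'(4) t k by blast
  qed
qed

lemma submodule_over_line_extension:
  assumes "subring T R" "submodule_over T K" "submodule_over T E" "x \<in> carrier R"
  shows "submodule_over T (line_extension K x E)"
  unfolding line_extension_def
  using assms by (intro submodule_over_set_add submodule_over_r_coset)

lemma line_extension_base_subset:
  assumes "\<zero> \<in> K" "E \<subseteq> carrier R" "x \<in> carrier R"
  shows "E \<subseteq> line_extension K x E"
proof
  fix e assume "e \<in> E"
  moreover from this have "e = \<zero> \<otimes> x \<oplus> e" using assms by (simp add: subset_iff)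
  ultimately show "e \<in> line_extension K x E" unfolding line_extension_mem_iff using assms(1) by blast
qed

lemma line_extension_smult_mem:
  assumes "\<zero> \<in> E" "K \<subseteq> carrier R" "k \<in> K" "x \<in> carrier R"
  shows "k \<otimes> x \<in> line_extension K x E"
proof -
  have "k \<otimes> x = k \<otimes> x \<oplus> \<zero>" using assms by (simp add: subset_iff)
  then show ?thesis unfolding line_extension_mem_iff using assms(1,3) by blast
qed

lemma line_extension_subset_subring:
  assumes "subring B R" "K \<subseteq> B" "E \<subseteq> B" "x \<in> B"
  shows "line_extension K x E \<subseteq> B"
  using subringE(6,7)[OF assms(1)] assms(2-4) by (auto simp: line_extension_mem_iff subset_iff)

lemma line_extension_mono: "K \<subseteq> K' \<Longrightarrow> E \<subseteq> E' \<Longrightarrow> line_extension K x E \<subseteq> line_extension K' x E'"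
  unfolding subset_iff line_extension_mem_iff by blast

lemma ideal_line_extension:
  assumes I: "ideal I R" and a: "a \<in> carrier R"
  shows "ideal (line_extension (carrier R) a I) R"
  using submodule_over_line_extension[OF carrier_is_subring _ _ a] I
    submodule_over_subring[OF carrier_is_subring subset_refl]
  unfolding ideal_iff_submodule_over by blast

lemma subring_set_add:
  assumes A: "subring A R" and Z: "submodule_over A Z"
    and mult: "\<And>y z. y \<in> Z \<Longrightarrow> z \<in> Z \<Longrightarrow> y \<otimes> z \<in> Z <+>\<^bsub>R\<^esub> A"
  shows "subring (Z <+>\<^bsub>R\<^esub> A) R"
proof -
  note A' = subringE[OF A] and Z' = submodule_overE[OF Z]
  have "submodule_over A (Z <+>\<^bsub>R\<^esub> A)"
    by (rule submodule_over_set_add[OF A Z submodule_over_subring[OF A subset_refl]])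
  note S = submodule_overE[OF this]
  have ZA: "z \<oplus> a \<in> Z <+>\<^bsub>R\<^esub> A" if "z \<in> Z" "a \<in> A" for z a using that unfolding mem_set_add_iff by blast
  show ?thesis
  proof (rule subringI[OF S(1)])
    show "\<one> \<in> Z <+>\<^bsub>R\<^esub> A" using ZA[OF Z'(2) A'(3)] by simp
    fix x y assume "x \<in> Z <+>\<^bsub>R\<^esub> A" and y: "y \<in> Z <+>\<^bsub>R\<^esub> A"
    then obtain z a w b where x: "x = z \<oplus> a" "z \<in> Z" "a \<in> A" and w: "y = w \<oplus> b" "w \<in> Z" "b \<in> A"
      unfolding mem_set_add_iff by blast
    have R: "z \<in> carrier R" "a \<in> carrier R" "w \<in> carrier R" "b \<in> carrier R"
      using x w A'(1) Z'(1) by auto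
    have "x \<otimes> y = z \<otimes> w \<oplus> ((b \<otimes> z \<oplus> a \<otimes> w) \<oplus> a \<otimes> b)"
      unfolding x w using R by algebra
    also have "\<dots> \<in> Z <+>\<^bsub>R\<^esub> A"
      using S(3)[OF mult ZA] Z'(3,4) A'(6) x w by simp
    finally show "x \<otimes> y \<in> Z <+>\<^bsub>R\<^esub> A" .
  qed (use S in auto)
qed

lemma subring_set_add_ideal:
  assumes A: "subring A R" and I: "ideal I (R\<lparr>carrier := A\<rparr>)" and V: "subring V R" "V \<subseteq> A"
  shows "subring (I <+>\<^bsub>R\<^esub> V) R" and "I \<subseteq> I <+>\<^bsub>R\<^esub> V" and "V \<subseteq> I <+>\<^bsub>R\<^esub> V"
    and "I <+>\<^bsub>R\<^esub> V \<subseteq> A"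
proof -
  have IA: "I \<subseteq> A" "submodule_over A I" using I unfolding ideal_of_subring_iff[OF A] by auto
  note A' = subringE[OF A] and V' = subringE[OF V(1)] and I' = submodule_overE[OF IA(2)]
  show sub: "I \<subseteq> I <+>\<^bsub>R\<^esub> V"
  proof
    fix i assume "i \<in> I"
    then show "i \<in> I <+>\<^bsub>R\<^esub> V" unfolding mem_set_add_iff using V'(2) I'(1) by force
  qed
  show "V \<subseteq> I <+>\<^bsub>R\<^esub> V"
  proof
    fix v assume "v \<in> V"
    then show "v \<in> I <+>\<^bsub>R\<^esub> V" unfolding mem_set_add_iff using I'(2) V'(1) by force
  qed
  show "I <+>\<^bsub>R\<^esub> V \<subseteq> A" using A'(7) IA(1) V(2) unfolding mem_set_add_iff subset_iff by blast
  show "subring (I <+>\<^bsub>R\<^esub> V) R"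
  proof (rule subring_set_add[OF V(1) submodule_over_mono[OF IA(2) V(2)]])
    fix y z assume "y \<in> I" "z \<in> I"
    then have "y \<otimes> z \<in> I" using I'(4) IA(1) by blast
    then show "y \<otimes> z \<in> I <+>\<^bsub>R\<^esub> V" using sub by blast
  qed
qed

lemma subring_line_extension:
  assumes E: "subring E R" and K: "subring K R" and "E \<subseteq> K" and x: "x \<in> carrier R"
    and sq: "\<And>k. k \<in> K \<Longrightarrow> k \<otimes> (x \<otimes> x) \<in> line_extension K x E"
  shows "subring (line_extension K x E) R"
  unfolding line_extension_def
proof (rule subring_set_add[OF E])
  note K' = subringE[OF K]
  show "submodule_over E (K #> x)"
    by (rule submodule_over_r_coset[OF E submodule_over_subring[OF K \<open>E \<subseteq> K\<close>] x])
  fix y z assume "y \<in> K #> x" "z \<in> K #> x"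
  then obtain k l where kl: "k \<in> K" "l \<in> K" "y = k \<otimes> x" "z = l \<otimes> x" unfolding r_coset_def by blast
  then have "y \<otimes> z = (k \<otimes> l) \<otimes> (x \<otimes> x)"
    using K'(1) x by (simp add: m_ac subset_iff)
  then show "y \<otimes> z \<in> (K #> x) <+>\<^bsub>R\<^esub> E"
    using sq[OF K'(6)[OF kl(1,2)]] unfolding line_extension_def by simp
qed

end

section \<open>Prime ideals and integral extensions\<close>

lemma integral_extensionD:
  assumes "integral_extension T R"
  shows "subring T R" and "\<And>x. x \<in> carrier R \<Longrightarrow> integral_over T R x"
  using assms unfolding integral_extension_def ring_extension_def by auto

lemma integral_extension_mono:
  assumes "integral_extension T R" "subring U R" "T \<subseteq> U"
  shows "integral_extension U R"
  using assms unfolding integral_extension_def ring_extension_def integral_over_def by blast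

context cring
begin

definition maximal_avoiding :: "'a set \<Rightarrow> 'a set \<Rightarrow> bool" where
  "maximal_avoiding M Q \<longleftrightarrow> ideal Q R \<and> Q \<inter> M = {} \<and>
     (\<forall>I. ideal I R \<longrightarrow> Q \<subseteq> I \<longrightarrow> I \<inter> M = {} \<longrightarrow> I = Q)"

lemma exists_maximal_avoiding:
  assumes "ideal J R" "J \<inter> M = {}"
  obtains Q where "maximal_avoiding M Q" "J \<subseteq> Q"
proof -
  let ?F = "{I. ideal I R \<and> J \<subseteq> I \<and> I \<inter> M = {}}"
  have "\<exists>Q\<in>?F. \<forall>I\<in>?F. Q \<subseteq> I \<longrightarrow> I = Q"
  proof (rule subset_Zorn_nonempty)
    show "?F \<noteq> {}" using assms by blast
    fix C assume C: "C \<noteq> {}" "subset.chain ?F C"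
    then have "subset.chain {I. ideal I R} C" unfolding subset_chain_def by blast
    then have "ideal (\<Union>C) R" using chain_Union_is_ideal[of C] C(1) by simp
    then show "\<Union>C \<in> ?F" using C unfolding subset_chain_def by blast
  qed
  then obtain Q where Q: "Q \<in> ?F" and max: "\<forall>I\<in>?F. Q \<subseteq> I \<longrightarrow> I = Q" by (rule bexE)
  have "I = Q" if "ideal I R" "Q \<subseteq> I" "I \<inter> M = {}" for I
    using max[rule_format, of I] that Q by blast
  then have "maximal_avoiding M Q" using Q unfolding maximal_avoiding_def by blast
  then show ?thesis using that Q by blast
qed

lemma maximal_avoiding_meets:
  assumes Q: "maximal_avoiding M Q" and a: "a \<in> carrier R" "a \<notin> Q"
  obtains r q where "r \<in> carrier R" "q \<in> Q" "r \<otimes> a \<oplus> q \<in> M"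
proof -
  let ?J = "line_extension (carrier R) a Q"
  interpret Q: ideal Q R using Q unfolding maximal_avoiding_def by blast
  have "Q \<subseteq> ?J" using Q.a_subset a(1) by (simp add: line_extension_base_subset)
  moreover have "\<one> \<otimes> a \<in> ?J"
    using a(1) additive_subgroup.zero_closed[OF Q.is_additive_subgroup]
    by (intro line_extension_smult_mem) auto
  then have "?J \<noteq> Q" using a by auto
  ultimately have "?J \<inter> M \<noteq> {}"
    using Q ideal_line_extension[OF Q.is_ideal a(1)] unfolding maximal_avoiding_def by blast
  then show ?thesis using that unfolding line_extension_mem_iff disjoint_iff by blast
qed

lemma maximal_avoiding_imp_primeideal:
  assumes M: "submonoid M R" and Q: "maximal_avoiding M Q"
  shows "primeideal Q R"
  unfolding primeideal_iff
proof (intro conjI ballI impI)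
  show "ideal Q R" using Q unfolding maximal_avoiding_def by blast
  have disj: "Q \<inter> M = {}" using Q unfolding maximal_avoiding_def by blast
  then show "\<one> \<notin> Q" using submonoid.one_closed[OF M] by blast
  interpret Q: ideal Q R by fact
  fix a b assume ab: "a \<in> carrier R" "b \<in> carrier R" "a \<otimes> b \<in> Q"
  show "a \<in> Q \<or> b \<in> Q"
  proof (rule ccontr)
    assume "\<not> (a \<in> Q \<or> b \<in> Q)"
    then obtain r q s p where r: "r \<in> carrier R" "q \<in> Q" "r \<otimes> a \<oplus> q \<in> M"
      and s: "s \<in> carrier R" "p \<in> Q" "s \<otimes> b \<oplus> p \<in> M"
      using maximal_avoiding_meets[OF Q] ab(1,2) by metis
    have carr: "q \<in> carrier R" "p \<in> carrier R" using r s Q.Icarr by auto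
    have "(r \<otimes> a \<oplus> q) \<otimes> (s \<otimes> b \<oplus> p) =
        (r \<otimes> s) \<otimes> (a \<otimes> b) \<oplus> ((r \<otimes> a) \<otimes> p \<oplus> (s \<otimes> b \<oplus> p) \<otimes> q)"
      using r(1) s(1) carr ab by algebra
    also have "\<dots> \<in> Q" using r s ab carr by (simp add: Q.I_l_closed)
    finally show False using submonoid.m_closed[OF M r(3) s(3)] disj by blast
  qed
qed

lemma exists_maximalideal:
  assumes "ideal J R" "\<one> \<notin> J"
  obtains Q where "maximalideal Q R" "J \<subseteq> Q"
proof -
  obtain Q where Q: "maximal_avoiding {\<one>} Q" "J \<subseteq> Q"
    using exists_maximal_avoiding[of J "{\<one>}"] assms by blast
  then have "maximalideal Q R" unfolding maximalideal_iff maximal_avoiding_def by blast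
  then show ?thesis using that Q(2) by blast
qed

lemma maximalideal_inverse_mod:
  assumes Q: "maximalideal Q R" and x: "x \<in> carrier R" "x \<notin> Q"
  obtains y q where "y \<in> carrier R" "q \<in> Q" "y \<otimes> x \<oplus> q = \<one>"
proof -
  have "maximal_avoiding {\<one>} Q"
    using Q unfolding maximalideal_iff maximal_avoiding_def by blast
  then show ?thesis using maximal_avoiding_meets[OF _ x] that by blast
qed

lemma integral_overE:
  assumes "integral_over T R x"
  obtains l where "set l \<subseteq> T" "eval (\<one> # l) x = \<zero>"
proof -
  obtain p where p: "p \<noteq> []" "set p \<subseteq> T" "lead_coeff p = \<one>" "eval p x = \<zero>"
    using assms unfolding integral_over_def by blast
  then show ?thesis using that[of "tl p"] by (cases p) auto
qed

text \<open>Multiplying a monic equation of degree \<open>n\<close> for \<open>s\<close> by \<open>p\<^sup>n\<close> turns it into a monic equation for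
  \<open>t \<equiv> p s\<close> whose lower coefficients are all divisible by \<open>p\<close>.\<close>

lemma nat_pow_mult_monic_eval:
  assumes T: "subring T R" and Q: "ideal Q R" and pt: "p \<in> T" "t \<in> T" and s: "s \<in> carrier R"
    and pst: "p \<otimes> s \<ominus> t \<in> Q" and l: "set l \<subseteq> T"
  shows "\<exists>c\<in>T. p [^] length l \<otimes> eval (\<one> # l) s \<ominus> (t [^] length l \<oplus> p \<otimes> c) \<in> Q"
  using l
proof (induction l rule: rev_induct)
  case Nil
  have "p [^] length [] \<otimes> eval [\<one>] s \<ominus> (t [^] length [] \<oplus> p \<otimes> \<zero>) = \<zero>"
    using pt subringE(1)[OF T] by (auto simp: r_neg minus_eq)
  then show ?case using submodule_overE(2)[OF ideal_imp_submodule_over[OF Q]] subringE(2)[OF T] by metis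
next
  case (snoc a l)
  note T' = subringE[OF T]
  interpret Q: ideal Q R by fact
  obtain c where c: "c \<in> T" "p [^] length l \<otimes> eval (\<one> # l) s \<ominus> (t [^] length l \<oplus> p \<otimes> c) \<in> Q"
    using snoc by auto
  define P N e where abbrev: "P = p [^] length l" "N = t [^] length l" "e = eval (\<one> # l) s"
  have a: "a \<in> T" and al: "set (\<one> # l) \<subseteq> carrier R" using snoc.prems T'(1) by auto
  have R: "a \<in> carrier R" "c \<in> carrier R" "p \<in> carrier R" "t \<in> carrier R"
    "P \<in> carrier R" "N \<in> carrier R" "e \<in> carrier R"
    using a c(1) pt T'(1) eval_in_carrier[OF al s] unfolding abbrev by auto
  have "P \<in> T" unfolding abbrev using subring_nat_pow_closed[OF T pt(1)] .
  then have c': "c \<otimes> t \<oplus> P \<otimes> a \<in> T" using c(1) pt a T'(6,7) by simp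
  have "eval (\<one> # l @ [a]) s = e \<otimes> s \<oplus> a"
    using eval_append_aux[OF al R(1) s] unfolding abbrev by simp
  moreover have "(P \<otimes> p) \<otimes> (e \<otimes> s \<oplus> a) \<ominus> (N \<otimes> t \<oplus> p \<otimes> (c \<otimes> t \<oplus> P \<otimes> a)) =
      (P \<otimes> e \<ominus> (N \<oplus> p \<otimes> c)) \<otimes> (p \<otimes> s) \<oplus> (N \<oplus> p \<otimes> c) \<otimes> (p \<otimes> s \<ominus> t)"
    using R s by algebra
  moreover have "\<dots> \<in> Q"
    using c(2) pst R s unfolding abbrev[symmetric]
    by (intro additive_subgroup.a_closed[OF Q.is_additive_subgroup] Q.I_l_closed Q.I_r_closed) auto
  ultimately show ?case
    unfolding length_append_singleton nat_pow_Suc abbrev(1,2)[symmetric] using c' by metis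
qed

lemma integral_over_scaled:
  assumes T: "subring T R" and Q: "ideal Q R" and pt: "p \<in> T" "t \<in> T" and s: "s \<in> carrier R"
    and pst: "p \<otimes> s \<ominus> t \<in> Q" and int: "integral_over T R s"
  obtains n :: nat and c where "c \<in> T" "t [^] n \<oplus> p \<otimes> c \<in> Q"
proof -
  obtain l where l: "set l \<subseteq> T" "eval (\<one> # l) s = \<zero>" using integral_overE[OF int] .
  obtain c where c: "c \<in> T" "p [^] length l \<otimes> \<zero> \<ominus> (t [^] length l \<oplus> p \<otimes> c) \<in> Q"
    using nat_pow_mult_monic_eval[OF T Q pt s pst l(1)] unfolding l(2) by blast
  have "c \<in> carrier R" "p \<in> carrier R" "t \<in> carrier R" using c(1) pt subringE(1)[OF T] by auto
  then have "t [^] length l \<oplus> p \<otimes> c = \<ominus> (p [^] length l \<otimes> \<zero> \<ominus> (t [^] length l \<oplus> p \<otimes> c))"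
    by (simp add: minus_eq)
  also have "\<dots> \<in> Q" using submodule_overE(5)[OF ideal_imp_submodule_over[OF Q] c(2)] .
  finally show ?thesis using that[OF c(1)] by blast
qed

theorem lying_over_containing:
  assumes ext: "integral_extension T R" and J: "ideal J R"
    and P: "primeideal P (R\<lparr>carrier := T\<rparr>)" and "J \<inter> T \<subseteq> P"
  obtains Q where "primeideal Q R" "J \<subseteq> Q" "Q \<inter> T = P"
proof -
  have T: "subring T R" using integral_extensionD(1)[OF ext] .
  note T' = subringE[OF T]
  have PT: "P \<subseteq> T" and P_sub: "submodule_over T P" and "\<one> \<notin> P"
    and prime: "\<And>a b. a \<in> T \<Longrightarrow> b \<in> T \<Longrightarrow> a \<otimes> b \<in> P \<Longrightarrow> a \<in> P \<or> b \<in> P"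
    using P unfolding primeideal_of_subring_iff[OF T] ideal_of_subring_iff[OF T] by auto
  have compl: "submonoid (T - P) R"
    using T'(1,3,6) prime \<open>\<one> \<notin> P\<close> by unfold_locales blast+
  obtain Q where Q: "maximal_avoiding (T - P) Q" "J \<subseteq> Q"
    using exists_maximal_avoiding[OF J, of "T - P"] \<open>J \<inter> T \<subseteq> P\<close> by blast
  then have QP: "Q \<inter> T \<subseteq> P" and QI: "ideal Q R" unfolding maximal_avoiding_def by auto
  note Q' = submodule_overE[OF ideal_imp_submodule_over[OF QI]]
  have "p \<in> Q" if p: "p \<in> P" for p
  proof (rule ccontr)
    assume "p \<notin> Q"
    have pR: "p \<in> T" "p \<in> carrier R" using p PT T'(1) by auto
    then obtain s q where s: "s \<in> carrier R" "q \<in> Q" "s \<otimes> p \<oplus> q \<in> T - P"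
      using maximal_avoiding_meets[OF Q(1) _ \<open>p \<notin> Q\<close>] by blast
    let ?t = "s \<otimes> p \<oplus> q"
    have qR: "q \<in> carrier R" using s(2) Q'(1) by blast
    have "p \<otimes> s \<ominus> ?t = \<ominus> q" using pR(2) s(1) qR by algebra
    then have "p \<otimes> s \<ominus> ?t \<in> Q" using Q'(5)[OF s(2)] by simp
    then obtain n :: nat and c where c: "c \<in> T" "?t [^] n \<oplus> p \<otimes> c \<in> Q"
      using integral_over_scaled[OF T QI pR(1) _ s(1) _ integral_extensionD(2)[OF ext s(1)]] s(3)
      by blast
    have tn: "?t [^] n \<in> T" using subring_nat_pow_closed[OF T, of ?t n] s(3) by blast
    have "p \<otimes> c \<in> P"
      using submodule_overE(4)[OF P_sub c(1) p] m_comm[OF pR(2)] T'(1) c(1) by auto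
    moreover have "?t [^] n \<oplus> p \<otimes> c \<in> P" using c tn pR(1) T'(6,7) QP by blast
    ultimately have "?t [^] n \<in> P" using submodule_over_add_iff(1)[OF P_sub] tn T'(1) by blast
    then show False using primeideal_of_subring_nat_pow[OF T P, of ?t n] s(3) by blast
  qed
  then have "Q \<inter> T = P" using QP PT by blast
  then show ?thesis using that maximal_avoiding_imp_primeideal[OF compl Q(1)] Q(2) by blast
qed

corollary lying_over:
  assumes ext: "integral_extension T R" and P: "primeideal P (R\<lparr>carrier := T\<rparr>)"
  obtains Q where "primeideal Q R" "Q \<inter> T = P"
proof -
  have T: "subring T R" using integral_extensionD(1)[OF ext] .
  have "submodule_over T P"
    using P unfolding primeideal_of_subring_iff[OF T] ideal_of_subring_iff[OF T] by blast
  then have "{\<zero>} \<inter> T \<subseteq> P" using submodule_overE(2) by blast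
  then show ?thesis using lying_over_containing[OF ext zeroideal P] that by blast
qed

theorem integral_incomparable:
  assumes ext: "integral_extension T R" and Q: "primeideal Q R"
    and J: "ideal J R" "Q \<subseteq> J" "J \<inter> T \<subseteq> Q"
  shows "J = Q"
proof (rule ccontr)
  note T' = subringE[OF integral_extensionD(1)[OF ext]]
  interpret Q: primeideal Q R by fact
  interpret J: ideal J R by fact
  assume "J \<noteq> Q"
  then obtain x where x: "x \<in> J" "x \<notin> Q" using J(2) by blast
  have xR: "x \<in> carrier R" using x(1) J.Icarr by blast
  have False if "set l \<subseteq> T" "eval (\<one> # l) x \<in> Q" for l
    using that
  proof (induction l rule: rev_induct)
    case Nil
    then show ?case using Q unfolding primeideal_iff by simp
  next
    case (snoc a l)
    define e where "e = eval (\<one> # l) x"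
    have a: "a \<in> T" "a \<in> carrier R" and l: "set (\<one> # l) \<subseteq> carrier R" using snoc.prems T'(1) by auto
    have e: "e \<in> carrier R" unfolding e_def by (rule eval_in_carrier[OF l xR])
    have ea: "e \<otimes> x \<oplus> a \<in> Q"
      using snoc.prems(2) eval_append_aux[OF l a(2) xR] unfolding e_def by simp
    then have "a \<oplus> e \<otimes> x \<in> J" using J(2) e xR a by (simp add: a_comm subset_iff)
    then have "a \<in> J"
      using submodule_over_add_iff(1)[OF ideal_imp_submodule_over[OF J(1)] J.I_l_closed[OF x(1) e] a(2)]
      by blast
    then have "a \<in> Q" using J(3) a(1) by blast
    then have "e \<otimes> x \<in> Q"
      using submodule_over_add_iff(1)[OF ideal_imp_submodule_over[OF Q.is_ideal]] ea e xR by simp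
    then have "e \<in> Q" using Q.I_prime[OF e xR] x(2) by blast
    then show False using snoc unfolding e_def by simp
  qed
  moreover obtain l where "set l \<subseteq> T" "eval (\<one> # l) x = \<zero>"
    using integral_overE[OF integral_extensionD(2)[OF ext xR]] .
  ultimately show False using additive_subgroup.zero_closed[OF Q.is_additive_subgroup] by metis
qed

theorem maximalideal_contract_iff:
  assumes ext: "integral_extension T R" and Q: "primeideal Q R"
  shows "maximalideal (Q \<inter> T) (R\<lparr>carrier := T\<rparr>) \<longleftrightarrow> maximalideal Q R"
proof
  have T: "subring T R" using integral_extensionD(1)[OF ext] .
  have QI: "ideal Q R" "\<one> \<notin> Q" using Q unfolding primeideal_iff by auto
  show "maximalideal Q R" if max: "maximalideal (Q \<inter> T) (R\<lparr>carrier := T\<rparr>)"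
  proof -
    have "J = Q" if J: "ideal J R" "Q \<subseteq> J" "\<one> \<notin> J" for J
    proof -
      have "J \<inter> T = Q \<inter> T"
        using max ideal_contract[OF T J(1)] J(2,3) unfolding maximalideal_of_subring_iff[OF T] by blast
      then show ?thesis using integral_incomparable[OF ext Q J(1,2)] by blast
    qed
    then show ?thesis unfolding maximalideal_iff using QI by blast
  qed
  show "maximalideal (Q \<inter> T) (R\<lparr>carrier := T\<rparr>)" if max: "maximalideal Q R"
  proof -
    interpret T: cring "R\<lparr>carrier := T\<rparr>" by (rule subring_is_cring[OF T])
    obtain P where P: "maximalideal P (R\<lparr>carrier := T\<rparr>)" "Q \<inter> T \<subseteq> P"
      using T.exists_maximalideal[OF ideal_contract[OF T QI(1)]] QI(2) by auto
    obtain Q' where Q': "primeideal Q' R" "Q \<subseteq> Q'" "Q' \<inter> T = P"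
      using lying_over_containing[OF ext QI(1) T.maximalideal_prime[OF P(1)] P(2)] .
    then have "Q' = Q" using max unfolding maximalideal_iff primeideal_iff by blast
    then show ?thesis using P(1) Q'(3) by simp
  qed
qed

section \<open>Conductors\<close>

definition conductor :: "'a set \<Rightarrow> 'a set \<Rightarrow> 'a set" where
  "conductor A B = {a \<in> A. \<forall>b\<in>B. a \<otimes> b \<in> A}"

lemma conductor_subset: "conductor A B \<subseteq> A"
  unfolding conductor_def by blast

lemma submodule_over_conductor:
  assumes A: "subring A R" and B: "subring B R" and "A \<subseteq> B"
  shows "submodule_over B (conductor A B)"
proof (rule submodule_overI[OF B])
  note A' = subringE[OF A] and B' = subringE[OF B]
  have BR: "b \<in> carrier R" if "b \<in> B" for b using that B'(1) by blast
  show "conductor A B \<subseteq> carrier R" using conductor_subset A'(1) by blast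
  show "\<zero> \<in> conductor A B" unfolding conductor_def using A'(2) BR by simp
next
  fix a b assume "a \<in> conductor A B" "b \<in> conductor A B"
  then show "a \<oplus> b \<in> conductor A B"
    using subringE(7)[OF A] subringE(1)[OF B] \<open>A \<subseteq> B\<close> unfolding conductor_def
    by (simp add: l_distr subset_iff)
next
  fix t a assume t: "t \<in> B" and a: "a \<in> conductor A B"
  then have ta: "t \<otimes> a = a \<otimes> t" "a \<in> carrier R" "t \<in> carrier R"
    using subringE(1)[OF B] \<open>A \<subseteq> B\<close> m_comm[of t a] unfolding conductor_def by auto
  have "t \<otimes> a \<otimes> b \<in> A" if b: "b \<in> B" for b
  proof -
    have "t \<otimes> a \<otimes> b = a \<otimes> (t \<otimes> b)" using ta b subringE(1)[OF B] by (simp add: m_assoc subset_iff)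
    then show ?thesis using a subringE(6)[OF B t b] unfolding conductor_def by simp
  qed
  moreover have "t \<otimes> a \<in> A" using a t unfolding ta(1) conductor_def by simp
  ultimately show "t \<otimes> a \<in> conductor A B" unfolding conductor_def by blast
qed

lemma ideal_conductor:
  assumes A: "subring A R" and B: "subring B R" and "A \<subseteq> B"
  shows "ideal (conductor A B) (R\<lparr>carrier := A\<rparr>)"
  using submodule_over_mono[OF submodule_over_conductor[OF assms] \<open>A \<subseteq> B\<close>] conductor_subset
  unfolding ideal_of_subring_iff[OF A] by blast

lemma ideal_conductor_carrier:
  assumes "subring A R"
  shows "ideal (conductor A (carrier R)) R"
  using submodule_over_conductor[OF assms carrier_is_subring subringE(1)[OF assms]]
  unfolding ideal_iff_submodule_over .

lemma one_mem_conductor_iff: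
  assumes "subring A R" "subring B R" "A \<subseteq> B"
  shows "\<one> \<in> conductor A B \<longleftrightarrow> A = B"
  using subringE(3,6)[OF assms(1)] subringE(1)[OF assms(2)] assms(3)
  unfolding conductor_def by (auto simp: subset_iff)

lemma conductor_mult_trans:
  assumes "A \<subseteq> carrier R" "B \<subseteq> carrier R" "C \<subseteq> carrier R"
    and a: "a \<in> conductor A B" and b: "b \<in> conductor B C"
  shows "a \<otimes> b \<in> conductor A C"
proof -
  have "a \<otimes> b \<otimes> c \<in> A" if "c \<in> C" for c
  proof -
    have "a \<otimes> b \<otimes> c = a \<otimes> (b \<otimes> c)" using assms that unfolding conductor_def by (auto intro: m_assoc)
    then show ?thesis using a b that unfolding conductor_def by simp
  qed
  then show ?thesis using a b unfolding conductor_def by simp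
qed

lemma conductor_mult_Int:
  assumes A: "subring A R" and B: "subring B R" and C: "C \<subseteq> carrier R"
    and a: "a \<in> conductor A C" "a \<in> B" and b: "b \<in> conductor B C" "b \<in> A"
  shows "a \<otimes> b \<in> conductor (A \<inter> B) C"
proof -
  have carr: "a \<in> carrier R" "b \<in> carrier R" using a b subringE(1)[OF A] subringE(1)[OF B] by auto
  have "a \<otimes> b \<otimes> c \<in> A \<inter> B" if c: "c \<in> C" for c
  proof -
    have "a \<otimes> b \<otimes> c = b \<otimes> (a \<otimes> c)" "a \<otimes> b \<otimes> c = a \<otimes> (b \<otimes> c)" using carr c C by (simp_all add: m_ac subset_iff)
    then show ?thesis
      using a b c subringE(6)[OF A, of b "a \<otimes> c"] subringE(6)[OF B, of a "b \<otimes> c"]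
      unfolding conductor_def by simp
  qed
  moreover have "a \<otimes> b \<in> A \<inter> B"
    using a b subringE(6)[OF A] subringE(6)[OF B] unfolding conductor_def by simp
  ultimately show ?thesis unfolding conductor_def by blast
qed

section \<open>Nakayama's lemma\<close>

lemma submodule_over_foldr_line_extension:
  assumes "subring A R" "submodule_over A N" "set Us \<subseteq> carrier R"
  shows "submodule_over A (foldr (line_extension A) Us N)"
  using assms submodule_over_subring[OF assms(1) subset_refl]
  by (induction Us) (simp_all add: submodule_over_line_extension)

lemma foldr_line_extension_mono: "N \<subseteq> N' \<Longrightarrow> foldr (line_extension A) Us N \<subseteq> foldr (line_extension A) Us N'"
  by (induction Us) (simp_all add: line_extension_mono)

lemma foldr_line_extension_base_subset:
  assumes "subring A R" "N \<subseteq> carrier R" "set Us \<subseteq> carrier R"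
  shows "N \<subseteq> foldr (line_extension A) Us N \<and> foldr (line_extension A) Us N \<subseteq> carrier R"
  using assms(3)
proof (induction Us)
  case (Cons u Us)
  then show ?case
    using line_extension_base_subset[OF subringE(2)[OF assms(1)], of "foldr (line_extension A) Us N" u]
      line_extension_in_carrier[OF subringE(1)[OF assms(1)], of u "foldr (line_extension A) Us N"]
    by auto
qed (use assms(2) in simp)

text \<open>Writing \<open>u = a m + n\<close> and \<open>(1 - a c) m = e u + z\<close> with \<open>m \<in> M\<close>, \<open>n, z \<in> N\<close>, \<open>e \<in> A\<close> gives
  \<open>(1 - a c - a e) u \<in> N\<close>.\<close>

lemma nakayama_eliminate_generator:
  assumes A: "subring A R" and M: "submodule_over A M" and N: "submodule_over A N"
    and ac: "a \<in> A" "c \<in> A" and u: "u \<in> M" and gen: "M \<subseteq> line_extension M a N"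
    and span: "\<forall>y\<in>M. (\<one> \<ominus> a \<otimes> c) \<otimes> y \<in> line_extension A u N"
  shows "\<exists>c'\<in>A. \<forall>y\<in>M. (\<one> \<ominus> a \<otimes> c') \<otimes> y \<in> N"
proof -
  note A' = subringE[OF A] and N' = submodule_overE[OF N]
  have carr: "\<And>x. x \<in> A \<Longrightarrow> x \<in> carrier R" "\<And>x. x \<in> M \<Longrightarrow> x \<in> carrier R" "\<And>x. x \<in> N \<Longrightarrow> x \<in> carrier R"
    using A'(1) submodule_overE(1)[OF M] N'(1) by auto
  define d where "d = \<one> \<ominus> a \<otimes> c"
  have d: "d \<in> A" unfolding d_def using subring_minus_closed[OF A A'(3) A'(6)[OF ac]] .
  obtain m n where mn: "m \<in> M" "n \<in> N" "u = m \<otimes> a \<oplus> n"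
    using gen u unfolding line_extension_mem_iff subset_iff by blast
  obtain e z where ez: "e \<in> A" "z \<in> N" "d \<otimes> m = e \<otimes> u \<oplus> z"
    using span mn(1) unfolding line_extension_mem_iff d_def by blast
  have R: "a \<in> carrier R" "c \<in> carrier R" "d \<in> carrier R" "e \<in> carrier R" "m \<in> carrier R"
    "n \<in> carrier R" "z \<in> carrier R" "u \<in> carrier R"
    using carr ac d ez mn u by auto
  have "(d \<ominus> a \<otimes> e) \<otimes> u = d \<otimes> (m \<otimes> a \<oplus> n) \<ominus> a \<otimes> (e \<otimes> u)"
    using R unfolding mn(3)[symmetric] by algebra
  also have "\<dots> = a \<otimes> (d \<otimes> m) \<oplus> d \<otimes> n \<ominus> a \<otimes> (e \<otimes> u)" using R by algebra
  also have "\<dots> = a \<otimes> z \<oplus> d \<otimes> n" unfolding ez(3) using R by algebra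
  finally have du: "(d \<ominus> a \<otimes> e) \<otimes> u \<in> N" using N'(3,4) ac(1) d ez(2) mn(2) by simp
  define c' where "c' = c \<oplus> e \<oplus> c \<ominus> a \<otimes> (c \<oplus> e) \<otimes> c"
  have c': "c' \<in> A" unfolding c'_def using ac ez(1) A'(6,7) by (intro subring_minus_closed[OF A]) simp_all
  have "(\<one> \<ominus> a \<otimes> c') \<otimes> y \<in> N" if y: "y \<in> M" for y
  proof -
    obtain f w where fw: "f \<in> A" "w \<in> N" "d \<otimes> y = f \<otimes> u \<oplus> w"
      using span y unfolding line_extension_mem_iff d_def by blast
    have R': "f \<in> carrier R" "w \<in> carrier R" "y \<in> carrier R" using carr fw y by auto
    have "(\<one> \<ominus> a \<otimes> c') \<otimes> y = (d \<ominus> a \<otimes> e) \<otimes> (d \<otimes> y)"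
      unfolding c'_def d_def using R R' by algebra
    also have "\<dots> = f \<otimes> ((d \<ominus> a \<otimes> e) \<otimes> u) \<oplus> (d \<ominus> a \<otimes> e) \<otimes> w"
      unfolding fw(3) using R R' by algebra
    also have "\<dots> \<in> N"
      using N'(3,4) fw du subring_minus_closed[OF A d A'(6)[OF ac(1) ez(1)]] by simp
    finally show ?thesis .
  qed
  then show ?thesis using c' by blast
qed

theorem nakayama:
  assumes A: "subring A R" and M: "submodule_over A M" and N: "submodule_over A N"
    and Us: "set Us \<subseteq> M" "M \<subseteq> foldr (line_extension A) Us N"
    and a: "a \<in> A" and gen: "M \<subseteq> line_extension M a N"
  shows "\<exists>c\<in>A. \<forall>y\<in>M. (\<one> \<ominus> a \<otimes> c) \<otimes> y \<in> N"
proof -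
  have carr: "a \<in> carrier R" "M \<subseteq> carrier R" "N \<subseteq> carrier R"
    using a subringE(1)[OF A] submodule_overE(1) M N by auto
  have "\<one> \<ominus> a \<otimes> \<zero> = \<one>" using carr by (simp add: minus_eq)
  then have "\<forall>y\<in>M. (\<one> \<ominus> a \<otimes> \<zero>) \<otimes> y \<in> foldr (line_extension A) Us N"
    using carr(2) Us(2) by (simp add: subset_iff)
  then have "\<exists>c\<in>A. \<forall>y\<in>M. (\<one> \<ominus> a \<otimes> c) \<otimes> y \<in> foldr (line_extension A) Us N"
    using subringE(2)[OF A] by blast
  then show ?thesis
    using Us(1)
  proof (induction Us)
    case (Cons u Us)
    let ?N = "foldr (line_extension A) Us N"
    have Us: "set Us \<subseteq> carrier R" using Cons.prems(2) carr by auto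
    have "N \<subseteq> ?N" using foldr_line_extension_base_subset[OF A carr(3) Us] by blast
    then have "M \<subseteq> line_extension M a ?N" using gen line_extension_mono[OF subset_refl] by blast
    then have "\<exists>c\<in>A. \<forall>y\<in>M. (\<one> \<ominus> a \<otimes> c) \<otimes> y \<in> ?N"
      using Cons.prems a nakayama_eliminate_generator[OF A M submodule_over_foldr_line_extension[OF A N Us]]
      by auto
    then show ?case using Cons by simp
  qed simp
qed

section \<open>Minimal extensions\<close>

definition minimal_extension :: "'a set \<Rightarrow> 'a set \<Rightarrow> bool" where
  "minimal_extension A B \<longleftrightarrow> subring A R \<and> subring B R \<and> A \<subset> B \<and>
     (\<forall>C. subring C R \<longrightarrow> A \<subseteq> C \<longrightarrow> C \<subseteq> B \<longrightarrow> C = A \<or> C = B)"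

lemma minimal_extensionD:
  assumes "minimal_extension A B"
  shows "subring A R" and "subring B R" and "A \<subset> B"
    and "\<And>C. subring C R \<Longrightarrow> A \<subseteq> C \<Longrightarrow> C \<subseteq> B \<Longrightarrow> C = A \<or> C = B"
  using assms unfolding minimal_extension_def by auto

lemma minimal_extension_line_extension:
  assumes AB: "minimal_extension A B" and y: "y \<in> B" and b: "b \<in> B" "b \<otimes> y \<notin> A"
  shows "line_extension B y A = B"
proof -
  note AB' = minimal_extensionD[OF AB]
  note A' = subringE[OF AB'(1)] and B' = subringE[OF AB'(2)]
  have AB: "A \<subseteq> B" using AB'(3) by blast
  have yR: "y \<in> carrier R" using y B'(1) by blast
  let ?L = "line_extension B y A"
  have "subring ?L R"
  proof (rule subring_line_extension[OF AB'(1,2) AB yR])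
    fix k assume k: "k \<in> B"
    then have "k \<otimes> (y \<otimes> y) = (k \<otimes> y) \<otimes> y" using yR B'(1) by (simp add: m_assoc subset_iff)
    then show "k \<otimes> (y \<otimes> y) \<in> ?L"
      using line_extension_smult_mem[OF A'(2) B'(1) B'(6)[OF k y] yR] by simp
  qed
  moreover have "A \<subseteq> ?L" by (rule line_extension_base_subset[OF B'(2) A'(1) yR])
  moreover have "?L \<subseteq> B" by (rule line_extension_subset_subring[OF AB'(2) subset_refl AB y])
  moreover have "b \<otimes> y \<in> ?L" by (rule line_extension_smult_mem[OF A'(2) B'(1) b(1) yR])
  ultimately show ?thesis using AB'(4) b(2) by blast
qed

lemma submodule_over_Span:
  assumes A: "subring A R" and Us: "set Us \<subseteq> carrier R"
  shows "submodule_over A (Span A Us)"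
proof -
  have "submodule_over A {\<zero>}"
    using ideal_imp_submodule_over[OF zeroideal] submodule_over_mono subringE(1)[OF A] by blast
  then show ?thesis using submodule_over_foldr_line_extension[OF A _ Us] by simp
qed

lemma Span_base_mem:
  assumes A: "subring A R" and Us: "set Us \<subseteq> carrier R" and u: "u \<in> set Us"
  shows "u \<in> Span A Us"
  using Us u
proof (induction Us)
  case (Cons v Us)
  have S: "Span A Us \<subseteq> carrier R" "\<zero> \<in> Span A Us"
    using Cons.prems(1) submodule_overE(1,2)[OF submodule_over_Span[OF A, of Us]] by simp_all
  have "\<one> \<otimes> v \<in> line_extension A v (Span A Us)"
    using line_extension_smult_mem[OF S(2) subringE(1,3)[OF A]] Cons.prems by simp
  moreover have "Span A Us \<subseteq> line_extension A v (Span A Us)"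
    using line_extension_base_subset[OF subringE(2)[OF A] S(1)] Cons.prems by simp
  ultimately show ?case using Cons by auto
qed simp

lemma mult_Span_subset:
  assumes A: "subring A R" and M: "submodule_over A M" and Us: "set Us \<subseteq> carrier R"
    and b: "b \<in> carrier R" "\<And>u. u \<in> set Us \<Longrightarrow> b \<otimes> u \<in> M" and y: "y \<in> Span A Us"
  shows "b \<otimes> y \<in> M"
  using Us b(2) y
proof (induction Us arbitrary: y)
  case Nil
  then show ?case using b(1) submodule_overE(2)[OF M] by simp
next
  case (Cons u Us)
  then obtain a z where az: "a \<in> A" "z \<in> Span A Us" "y = a \<otimes> u \<oplus> z"
    unfolding Span.simps foldr.simps comp_apply line_extension_mem_iff by blast
  have "a \<in> carrier R" "u \<in> carrier R" "z \<in> carrier R"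
    using az Cons.prems(1) Span_in_carrier[OF subringE(1)[OF A]] subringE(1)[OF A] by auto
  then have "b \<otimes> y = a \<otimes> (b \<otimes> u) \<oplus> b \<otimes> z" unfolding az(3) using b(1) by algebra
  then show ?case using submodule_overE(3,4)[OF M] az Cons by simp
qed

lemma eval_mem_Span_exp_base: "set l \<subseteq> A \<Longrightarrow> eval l b \<in> Span A (exp_base b (length l))"
  by (induction l) (auto simp: exp_base_def line_extension_mem_iff)

lemma integral_over_imp_nat_pow_mem_Span:
  assumes A: "subring A R" and b: "b \<in> carrier R" and int: "integral_over A R b"
  obtains n :: nat where "b [^] n \<in> Span A (exp_base b n)"
proof -
  obtain l where l: "set l \<subseteq> A" "eval (\<one> # l) b = \<zero>" using integral_overE[OF int] .
  let ?M = "Span A (exp_base b (length l))"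
  have M: "submodule_over A ?M" by (rule submodule_over_Span[OF A exp_base_closed[OF b]])
  have e: "eval l b \<in> ?M" by (rule eval_mem_Span_exp_base[OF l(1)])
  have "b [^] length l = \<ominus> eval l b"
    using l(2) b e submodule_overE(1)[OF M] by (simp add: minus_equality subset_iff)
  then show ?thesis using that submodule_overE(5)[OF M e] by metis
qed

lemma integral_over_imp_Span_exp_base_closed:
  assumes A: "subring A R" and b: "b \<in> carrier R" and int: "integral_over A R b"
  obtains n where "\<one> \<in> Span A (exp_base b n)"
    "\<And>y. y \<in> Span A (exp_base b n) \<Longrightarrow> b \<otimes> y \<in> Span A (exp_base b n)"
proof -
  obtain n :: nat where n: "b [^] n \<in> Span A (exp_base b n)"
    using integral_over_imp_nat_pow_mem_Span[OF A b int] .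
  let ?M = "Span A (exp_base b n)"
  have pow: "b [^] i \<in> ?M" if "i \<le> n" for i
  proof (cases "i = n")
    case False
    then have "b [^] i \<in> set (exp_base b n)" using that unfolding exp_base_def by simp
    then show ?thesis using Span_base_mem[OF A exp_base_closed[OF b]] by blast
  qed (use n in simp)
  have "b \<otimes> u \<in> ?M" if u: "u \<in> set (exp_base b n)" for u
  proof -
    obtain i where "i < n" "u = b [^] i" using u unfolding exp_base_def by auto
    then show ?thesis using pow[of "Suc i"] b by (simp add: m_comm)
  qed
  then have "b \<otimes> y \<in> ?M" if "y \<in> ?M" for y
    using mult_Span_subset[OF A submodule_over_Span[OF A exp_base_closed[OF b]] exp_base_closed[OF b] b] that
    by blast
  moreover have "\<one> \<in> ?M" using pow[of 0] by simp
  ultimately show ?thesis using that by blast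
qed

lemma subring_multipliers:
  assumes M: "submodule_over A M"
  shows "subring {y \<in> carrier R. \<forall>x\<in>M. y \<otimes> x \<in> M} R"
  using submodule_overE[OF M]
  by (intro subringI) (auto simp: l_minus l_distr m_assoc subset_iff)

text \<open>The multipliers of \<open>M = A[b]\<close> form a ring containing \<open>A\<close> and \<open>b\<close>, so by minimality all of \<open>B\<close>
  multiplies \<open>M\<close>; as \<open>1 \<in> M\<close>, this gives \<open>B \<subseteq> M\<close>.\<close>

lemma minimal_extension_finitely_generated:
  assumes AB: "minimal_extension A B" and b: "b \<in> B" "b \<notin> A" and int: "integral_over A R b"
  obtains Us where "set Us \<subseteq> B" "B \<subseteq> Span A Us"
proof -
  note AB' = minimal_extensionD[OF AB]
  have bR: "b \<in> carrier R" using b subringE(1)[OF AB'(2)] by blast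
  obtain n where n: "\<one> \<in> Span A (exp_base b n)"
    "\<And>y. y \<in> Span A (exp_base b n) \<Longrightarrow> b \<otimes> y \<in> Span A (exp_base b n)"
    using integral_over_imp_Span_exp_base_closed[OF AB'(1) bR int] by blast
  define M where "M = Span A (exp_base b n)"
  have M: "submodule_over A M" unfolding M_def by (rule submodule_over_Span[OF AB'(1) exp_base_closed[OF bR]])
  define D where "D = {y \<in> carrier R. \<forall>x\<in>M. y \<otimes> x \<in> M}"
  have "subring (B \<inter> D) R"
    using subring_inter[OF AB'(2) subring_multipliers[OF M]] unfolding D_def .
  moreover have "A \<subseteq> D" unfolding D_def using subringE(1)[OF AB'(1)] submodule_overE(4)[OF M] by blast
  moreover have "b \<in> D" unfolding D_def M_def using bR n(2) by blast
  ultimately have "B \<inter> D = B" using AB'(3) AB'(4)[of "B \<inter> D"] b by blast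
  moreover have "D \<subseteq> M" using n(1) unfolding D_def M_def by force
  ultimately have "B \<subseteq> Span A (exp_base b n)" unfolding M_def by blast
  moreover have "set (exp_base b n) \<subseteq> B"
    using subring_nat_pow_closed[OF AB'(2) b(1)] unfolding exp_base_def by auto
  ultimately show ?thesis using that by blast
qed

theorem maximalideal_conductor:
  assumes AB: "minimal_extension A B" and int: "\<And>b. b \<in> B \<Longrightarrow> integral_over A R b"
  shows "maximalideal (conductor A B) (R\<lparr>carrier := A\<rparr>)"
proof -
  note AB' = minimal_extensionD[OF AB]
  note A' = subringE[OF AB'(1)]
  have sub: "A \<subseteq> B" using AB'(3) by blast
  have "\<one> \<in> J" if J: "ideal J (R\<lparr>carrier := A\<rparr>)" "conductor A B \<subseteq> J" "J \<noteq> conductor A B" for J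
  proof -
    have JA: "J \<subseteq> A" "submodule_over A J" using J(1) unfolding ideal_of_subring_iff[OF AB'(1)] by auto
    obtain a where a: "a \<in> J" "a \<in> A" "a \<notin> conductor A B" using J(2,3) JA(1) by blast
    then obtain b' where "b' \<in> B" "a \<otimes> b' \<notin> A" unfolding conductor_def by blast
    then have "b' \<otimes> a \<notin> A" using m_comm a(2) A'(1) subringE(1)[OF AB'(2)] by (metis subsetD)
    then have gen: "B \<subseteq> line_extension B a A"
      using minimal_extension_line_extension[OF AB _ \<open>b' \<in> B\<close>] a(2) sub by blast
    obtain b where b: "b \<in> B" "b \<notin> A" using AB'(3) by blast
    obtain Us where Us: "set Us \<subseteq> B" "B \<subseteq> Span A Us"
      using minimal_extension_finitely_generated[OF AB b int[OF b(1)]] .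
    have "Span A Us \<subseteq> foldr (line_extension A) Us A"
      using foldr_line_extension_mono[of "{\<zero>}" A] A'(2) by simp
    then obtain c where c: "c \<in> A" "\<forall>y\<in>B. (\<one> \<ominus> a \<otimes> c) \<otimes> y \<in> A"
      using nakayama[OF AB'(1) submodule_over_subring[OF AB'(2) sub]
          submodule_over_subring[OF AB'(1) subset_refl] Us(1) _ a(2) gen] Us(2) by blast
    have ac: "a \<otimes> c \<in> J"
      using submodule_overE(4)[OF JA(2) c(1) a(1)] m_comm a(2) c(1) A'(1) by (metis subsetD)
    have "\<one> \<ominus> a \<otimes> c \<in> conductor A B"
      using subring_minus_closed[OF AB'(1) A'(3) A'(6)[OF a(2) c(1)]] c(2) unfolding conductor_def by blast
    then show ?thesis using J(2) submodule_over_add_iff(2)[OF JA(2) ac one_closed] by blast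
  qed
  moreover have "\<one> \<notin> conductor A B" using one_mem_conductor_iff[OF AB'(1,2) sub] AB'(3) by blast
  ultimately show ?thesis
    unfolding maximalideal_of_subring_iff[OF AB'(1)] using ideal_conductor[OF AB'(1,2) sub] by blast
qed

end

section \<open>Extensions with FCP\<close>

lemma (in ring) subring_of_subring_iff:
  assumes B: "subring B R"
  shows "subring Y (R\<lparr>carrier := B\<rparr>) \<longleftrightarrow> subring Y R \<and> Y \<subseteq> B"
proof -
  interpret B: ring "R\<lparr>carrier := B\<rparr>" by (rule subring_is_ring[OF B])
  show ?thesis
  proof (cases "Y \<subseteq> B")
    case True
    then show ?thesis
      using subring_iff[of Y] B.subring_iff[of Y] subringE(1)[OF B] by simp
  next
    case False
    then show ?thesis using subringE(1)[of Y "R\<lparr>carrier := B\<rparr>"] by auto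
  qed
qed

lemma intermediate_rings_of_subring:
  assumes "cring S" "subring B S"
  shows "intermediate_rings T (S\<lparr>carrier := B\<rparr>) = {Y. subring Y S \<and> T \<subseteq> Y \<and> Y \<subseteq> B}"
proof -
  interpret cring S by fact
  show ?thesis unfolding intermediate_rings_def subring_of_subring_iff[OF assms(2)] by blast
qed

lemma intermediate_rings_eq_interval:
  assumes "cring S" "subring B S" "R \<subseteq> T"
  shows "intermediate_rings T (S\<lparr>carrier := B\<rparr>) = intermediate_rings R S \<inter> {T..B}"
  unfolding intermediate_rings_of_subring[OF assms(1,2)] using assms(3) unfolding intermediate_rings_def by auto

lemma maxchain_iff:
  "subset.maxchain \<A> C \<longleftrightarrow>
     subset.chain \<A> C \<and> (\<forall>Z\<in>\<A>. (\<forall>Y\<in>C. Y \<subseteq> Z \<or> Z \<subseteq> Y) \<longrightarrow> Z \<in> C)"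
proof (intro iffI conjI ballI impI)
  assume C: "subset.maxchain \<A> C"
  show ch: "subset.chain \<A> C" by (rule subset.maxchain_imp_chain[OF C])
  fix Z assume "Z \<in> \<A>" "\<forall>Y\<in>C. Y \<subseteq> Z \<or> Z \<subseteq> Y"
  then have "subset.chain \<A> (insert Z C)" using ch by (simp add: subset_chain_insert)
  then show "Z \<in> C" using C unfolding subset.maxchain_def by blast
next
  assume C: "subset.chain \<A> C \<and> (\<forall>Z\<in>\<A>. (\<forall>Y\<in>C. Y \<subseteq> Z \<or> Z \<subseteq> Y) \<longrightarrow> Z \<in> C)"
  have "E \<subseteq> C" if E: "subset.chain \<A> E" "C \<subseteq> E" for E
  proof
    fix Z assume "Z \<in> E"
    moreover from this have "Z \<in> \<A>" using E(1) unfolding subset_chain_def by blast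
    moreover have "\<forall>Y\<in>C. Y \<subseteq> Z \<or> Z \<subseteq> Y"
      using subset.chain_total[OF E(1) _ \<open>Z \<in> E\<close>] E(2) by blast
    ultimately show "Z \<in> C" using C by blast
  qed
  then show "subset.maxchain \<A> C"
    using conjunct1[OF C] unfolding subset.maxchain_def by (simp add: less_le_not_le)
qed

lemma FCP_finite_chain:
  assumes "FCP R S" "\<A> \<subseteq> intermediate_rings R S" "subset.chain \<A> C"
  shows "finite C"
proof -
  have "subset.chain (intermediate_rings R S) C"
    using assms(2,3) by (auto simp: subset_chain_def)
  then show ?thesis using assms(1) unfolding FCP_def by blast
qed

lemma FCP_intermediate:
  assumes FCP: "FCP R S" and T: "T \<in> intermediate_rings R S" and B: "B \<in> intermediate_rings R S"
    and TB: "T \<subseteq> B"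
  shows "FCP T (S\<lparr>carrier := B\<rparr>)"
proof -
  interpret cring S using FCP unfolding FCP_def ring_extension_def by blast
  have sub: "subring T S" "subring B S" "R \<subseteq> T" using T B unfolding intermediate_rings_def by auto
  have "intermediate_rings T (S\<lparr>carrier := B\<rparr>) \<subseteq> intermediate_rings R S"
    unfolding intermediate_rings_eq_interval[OF is_cring sub(2,3)] by blast
  then show ?thesis
    using FCP_finite_chain[OF FCP] subring_is_cring[OF sub(2)] sub(1) TB
    unfolding FCP_def ring_extension_def subring_of_subring_iff[OF sub(2)] by blast
qed

corollary FCP_mono:
  assumes FCP: "FCP R S" and T: "T \<in> intermediate_rings R S"
  shows "FCP T S"
proof -
  interpret cring S using FCP unfolding FCP_def ring_extension_def by blast
  have "T \<subseteq> carrier S" using T subringE(1)[of T S] unfolding intermediate_rings_def by blast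
  moreover have "carrier S \<in> intermediate_rings R S"
    using T \<open>T \<subseteq> carrier S\<close> carrier_is_subring unfolding intermediate_rings_def by blast
  ultimately show ?thesis using FCP_intermediate[OF FCP T, of "carrier S"] by simp
qed

lemma FCP_exists_maximal:
  assumes "FCP R S" "\<A> \<subseteq> intermediate_rings R S" "\<A> \<noteq> {}"
  shows "\<exists>M\<in>\<A>. \<forall>N\<in>\<A>. M \<subseteq> N \<longrightarrow> N = M"
proof (rule subset_Zorn_nonempty[OF assms(3)])
  fix C assume "C \<noteq> {}" "subset.chain \<A> C"
  then have "\<Union>C \<in> C" using Union_in_chain FCP_finite_chain[OF assms(1,2)] by blast
  then show "\<Union>C \<in> \<A>" using \<open>subset.chain \<A> C\<close> unfolding subset_chain_def by blast
qed

lemma FCP_exists_minimal: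
  assumes "FCP R S" "\<A> \<subseteq> intermediate_rings R S" "\<A> \<noteq> {}"
  shows "\<exists>M\<in>\<A>. \<forall>N\<in>\<A>. N \<subseteq> M \<longrightarrow> N = M"
proof -
  obtain C where "subset.maxchain \<A> C" using subset.Hausdorff by blast
  then have ch: "subset.chain \<A> C" and max: "\<And>Z. Z \<in> \<A> \<Longrightarrow> \<forall>Y\<in>C. Y \<subseteq> Z \<or> Z \<subseteq> Y \<Longrightarrow> Z \<in> C"
    unfolding maxchain_iff by blast+
  have "C \<noteq> {}" using max assms(3) by blast
  then have Inter: "\<Inter>C \<in> C" using Inter_in_chain[OF FCP_finite_chain[OF assms(1,2) ch] _ ch] by blast
  show ?thesis
  proof (intro bexI ballI impI)
    show "\<Inter>C \<in> \<A>" using ch Inter by (auto simp: subset_chain_def)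
    fix N assume "N \<in> \<A>" "N \<subseteq> \<Inter>C"
    then have "N \<in> C" by (intro max) auto
    then show "N = \<Inter>C" using \<open>N \<subseteq> \<Inter>C\<close> by blast
  qed
qed

context cring
begin

lemma FCP_exists_minimal_extension:
  assumes FCP: "FCP T R" and A: "subring A R" "T \<subseteq> A" "A \<noteq> carrier R"
  obtains B where "minimal_extension A B"
proof -
  let ?\<A> = "{B \<in> intermediate_rings T R. A \<subset> B}"
  have "carrier R \<in> ?\<A>"
    using A subringE(1)[OF A(1)] carrier_is_subring unfolding intermediate_rings_def by blast
  then have "\<exists>B\<in>?\<A>. \<forall>C\<in>?\<A>. C \<subseteq> B \<longrightarrow> C = B" by (intro FCP_exists_minimal[OF FCP]) auto
  then obtain B where B: "B \<in> ?\<A>" and min: "\<forall>C\<in>?\<A>. C \<subseteq> B \<longrightarrow> C = B" by (rule bexE)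
  have "C = A \<or> C = B" if "subring C R" "A \<subseteq> C" "C \<subseteq> B" for C
    using min that A(2) unfolding intermediate_rings_def by blast
  then show ?thesis
    using that A(1) B unfolding minimal_extension_def intermediate_rings_def by blast
qed

text \<open>Choose \<open>A\<close> maximal with \<open>conductor A (carrier R) \<inter> T \<subseteq> P\<close> and use that
  \<open>conductor A B \<cdot> conductor B (carrier R) \<subseteq> conductor A (carrier R)\<close>.\<close>

lemma exists_minimal_extension_conductor_subset:
  assumes FCP: "FCP T R" and P: "primeideal P (R\<lparr>carrier := T\<rparr>)"
    and cond: "conductor T (carrier R) \<subseteq> P"
  obtains A B where "minimal_extension A B" "T \<subseteq> A" "conductor A B \<inter> T \<subseteq> P"
proof -
  have T: "subring T R" using FCP unfolding FCP_def ring_extension_def by blast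
  have prime: "\<And>a b. a \<in> T \<Longrightarrow> b \<in> T \<Longrightarrow> a \<otimes> b \<in> P \<Longrightarrow> a \<in> P \<or> b \<in> P" and "\<one> \<notin> P"
    using P unfolding primeideal_of_subring_iff[OF T] by auto
  let ?\<A> = "{A \<in> intermediate_rings T R. conductor A (carrier R) \<inter> T \<subseteq> P}"
  have "T \<in> ?\<A>" using T cond unfolding intermediate_rings_def by blast
  then have "\<exists>A\<in>?\<A>. \<forall>B\<in>?\<A>. A \<subseteq> B \<longrightarrow> B = A" by (intro FCP_exists_maximal[OF FCP]) auto
  then obtain A where "A \<in> ?\<A>" and max: "\<forall>B\<in>?\<A>. A \<subseteq> B \<longrightarrow> B = A" by (rule bexE)
  then have A: "subring A R" "T \<subseteq> A" and condA: "conductor A (carrier R) \<inter> T \<subseteq> P"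
    unfolding intermediate_rings_def by auto
  have "A \<noteq> carrier R"
    using one_mem_conductor_iff[OF A(1) carrier_is_subring subringE(1)[OF A(1)]] condA \<open>\<one> \<notin> P\<close> subringE(3)[OF T]
    by blast
  then obtain B where AB: "minimal_extension A B" using FCP_exists_minimal_extension[OF FCP A] by blast
  have B: "subring B R" "A \<subset> B" using minimal_extensionD(2,3)[OF AB] by auto
  then have "B \<notin> ?\<A>" using max by blast
  then obtain b where b: "b \<in> conductor B (carrier R)" "b \<in> T" "b \<notin> P"
    using A(2) B unfolding intermediate_rings_def by blast
  have "a \<in> P" if a: "a \<in> conductor A B" "a \<in> T" for a
  proof -
    have "a \<otimes> b \<in> conductor A (carrier R)"
      using conductor_mult_trans[OF _ _ _ a(1) b(1)] subringE(1)[OF A(1)] subringE(1)[OF B(1)] by blast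
    then have "a \<otimes> b \<in> P" using condA subringE(6)[OF T a(2) b(2)] by blast
    then show ?thesis using prime[OF a(2) b(2)] b(3) by blast
  qed
  then show ?thesis using that AB A(2) by blast
qed

theorem exists_critical_minimal_extension:
  assumes ext: "integral_extension T R" and FCP: "FCP T R"
    and P: "primeideal P (R\<lparr>carrier := T\<rparr>)" and cond: "conductor T (carrier R) \<subseteq> P"
  obtains A B Q where "minimal_extension A B" "T \<subseteq> A" "maximalideal Q R" "Q \<inter> T = P"
    "Q \<inter> A = conductor A B"
proof -
  have T: "subring T R" using integral_extensionD(1)[OF ext] .
  obtain A B where AB: "minimal_extension A B" and TA: "T \<subseteq> A" and condAB: "conductor A B \<inter> T \<subseteq> P"
    using exists_minimal_extension_conductor_subset[OF FCP P cond] .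
  note AB' = minimal_extensionD[OF AB]
  have extA: "integral_extension A R" using integral_extension_mono[OF ext AB'(1) TA] .
  have max: "maximalideal (conductor A B) (R\<lparr>carrier := A\<rparr>)"
    using maximalideal_conductor[OF AB] integral_extensionD(2)[OF extA] subringE(1)[OF AB'(2)] by blast
  obtain Q where Q: "primeideal Q R" "Q \<inter> A = conductor A B"
    using lying_over[OF extA cring.maximalideal_prime[OF subring_is_cring[OF AB'(1)] max]] .
  have Qmax: "maximalideal Q R" using maximalideal_contract_iff[OF extA Q(1)] Q(2) max by simp
  then have "maximalideal (Q \<inter> T) (R\<lparr>carrier := T\<rparr>)" using maximalideal_contract_iff[OF ext Q(1)] by simp
  moreover have "Q \<inter> T \<subseteq> P" using condAB Q(2) TA by blast
  ultimately have "Q \<inter> T = P"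
    using P unfolding maximalideal_of_subring_iff[OF T] primeideal_of_subring_iff[OF T] by blast
  then show ?thesis using that AB TA Qmax Q(2) by blast
qed

corollary maximalideal_if_conductor_subset:
  assumes ext: "integral_extension T R" and FCP: "FCP T R"
    and Q: "primeideal Q R" and cond: "conductor T (carrier R) \<subseteq> Q"
  shows "maximalideal Q R"
proof -
  have T: "subring T R" using integral_extensionD(1)[OF ext] .
  have "conductor T (carrier R) \<subseteq> Q \<inter> T" using cond conductor_subset by blast
  then obtain Q' where Q': "maximalideal Q' R" "Q' \<inter> T = Q \<inter> T"
    using exists_critical_minimal_extension[OF ext FCP primeideal_contract[OF T Q]] by metis
  then have "maximalideal (Q \<inter> T) (R\<lparr>carrier := T\<rparr>)"
    using maximalideal_contract_iff[OF ext maximalideal_prime[OF Q'(1)]] by simp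
  then show ?thesis using maximalideal_contract_iff[OF ext Q] by simp
qed

end

section \<open>u-closed extensions and injectivity on spectra\<close>

definition spec_injective :: "'a set \<Rightarrow> ('a, 'b) ring_scheme \<Rightarrow> bool" where
  "spec_injective T S \<longleftrightarrow> inj_on (\<lambda>Q. Q \<inter> T) {Q. primeideal Q S}"

lemma spec_injectiveD:
  "spec_injective T S \<Longrightarrow> primeideal Q S \<Longrightarrow> primeideal Q' S \<Longrightarrow> Q \<inter> T = Q' \<inter> T \<Longrightarrow> Q = Q'"
  unfolding spec_injective_def inj_on_def by blast

lemma spec_injective_mono:
  assumes "spec_injective T S" "T \<subseteq> U"
  shows "spec_injective U S"
  unfolding spec_injective_def
proof (rule inj_onI)
  fix Q Q' assume "Q \<in> {Q. primeideal Q S}" "Q' \<in> {Q. primeideal Q S}" "Q \<inter> U = Q' \<inter> U"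
  moreover from this have "Q \<inter> T = Q' \<inter> T" using assms(2) by blast
  ultimately show "Q = Q'" using spec_injectiveD[OF assms(1)] by simp
qed

context cring
begin

lemma u_closed_iff:
  "u_closed T R \<longleftrightarrow> subring T R \<and>
     (\<forall>b\<in>carrier R. b \<otimes> b \<ominus> b \<in> T \<longrightarrow> (b \<otimes> b \<ominus> b) \<otimes> b \<in> T \<longrightarrow> b \<in> T)"
proof -
  have "b [^] (2::nat) \<ominus> b = b \<otimes> b \<ominus> b" "b [^] (3::nat) \<ominus> b [^] (2::nat) = (b \<otimes> b \<ominus> b) \<otimes> b"
    if b: "b \<in> carrier R" for b
  proof -
    have "b [^] (2::nat) = b \<otimes> b" "b [^] (3::nat) = b \<otimes> b \<otimes> b"
      using b by (simp_all add: numeral_2_eq_2 numeral_3_eq_3)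
    moreover have "b \<otimes> b \<otimes> b \<ominus> b \<otimes> b = (b \<otimes> b \<ominus> b) \<otimes> b" using b by algebra
    ultimately show "b [^] (2::nat) \<ominus> b = b \<otimes> b \<ominus> b"
      "b [^] (3::nat) \<ominus> b [^] (2::nat) = (b \<otimes> b \<ominus> b) \<otimes> b" by simp_all
  qed
  then show ?thesis unfolding u_closed_def ring_extension_def using is_cring by auto
qed

lemma primes_maximal_imp_pi_regular:
  assumes I: "ideal I R" and max: "\<And>Q. primeideal Q R \<Longrightarrow> I \<subseteq> Q \<Longrightarrow> maximalideal Q R"
    and x: "x \<in> carrier R"
  obtains n :: nat and y where "y \<in> carrier R" "x [^] n \<otimes> (\<one> \<ominus> x \<otimes> y) \<in> I"
proof -
  define M where "M = {x [^] n \<otimes> (\<one> \<ominus> x \<otimes> y) | (n::nat) y. y \<in> carrier R}"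
  have memI: "x [^] n \<otimes> (\<one> \<ominus> x \<otimes> y) \<in> M" if "y \<in> carrier R" for n :: nat and y
    unfolding M_def using that by blast
  have "I \<inter> M \<noteq> {}"
  proof
    assume "I \<inter> M = {}"
    then obtain Q where Q: "maximal_avoiding M Q" "I \<subseteq> Q" using exists_maximal_avoiding[OF I] by blast
    have "submonoid M R"
    proof
      show "M \<subseteq> carrier R" using x unfolding M_def by auto
      show "\<one> \<in> M" using memI[of \<zero> 0] x by (simp add: minus_eq)
      fix a b assume "a \<in> M" "b \<in> M"
      then obtain n y m z where ab: "a = x [^] (n::nat) \<otimes> (\<one> \<ominus> x \<otimes> y)" "b = x [^] (m::nat) \<otimes> (\<one> \<ominus> x \<otimes> z)"
        and yz: "y \<in> carrier R" "z \<in> carrier R" unfolding M_def by blast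
      have pow: "x [^] n \<in> carrier R" "x [^] m \<in> carrier R" using x by auto
      have "(x [^] n \<otimes> (\<one> \<ominus> x \<otimes> y)) \<otimes> (x [^] m \<otimes> (\<one> \<ominus> x \<otimes> z)) =
          (x [^] n \<otimes> x [^] m) \<otimes> (\<one> \<ominus> x \<otimes> (y \<oplus> z \<ominus> x \<otimes> y \<otimes> z))"
        using pow x yz by algebra
      then show "a \<otimes> b \<in> M"
        using memI[of "y \<oplus> z \<ominus> x \<otimes> y \<otimes> z" "n + m"] x yz unfolding ab by (simp add: nat_pow_mult)
    qed
    then have Qprime: "primeideal Q R" using maximal_avoiding_imp_primeideal Q(1) by blast
    have disj: "Q \<inter> M = {}" using Q(1) unfolding maximal_avoiding_def by blast
    interpret Q: primeideal Q R by (rule Qprime)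
    have "x \<notin> Q" using memI[of \<zero> 1] x disj by (auto simp: minus_eq)
    then obtain y q where y: "y \<in> carrier R" "q \<in> Q" "y \<otimes> x \<oplus> q = \<one>"
      using maximalideal_inverse_mod[OF max[OF Qprime Q(2)] x] by blast
    have "(y \<otimes> x \<oplus> q) \<ominus> x \<otimes> y = q" using x y(1) Q.Icarr[OF y(2)] by algebra
    then have "q \<in> M" using memI[OF y(1), of 0] x y(1) Q.Icarr[OF y(2)] unfolding y(3) by simp
    then show False using y(2) disj by blast
  qed
  then show ?thesis using that unfolding M_def by blast
qed

text \<open>The idempotent modulo \<open>I\<close> is \<open>x z = (x y)\<^sup>n\<^sup>+\<^sup>1\<close>.\<close>

lemma pi_regular_imp_idempotent:
  assumes I: "ideal I R" and xy: "x \<in> carrier R" "y \<in> carrier R"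
    and reg: "x [^] (n::nat) \<otimes> (\<one> \<ominus> x \<otimes> y) \<in> I"
  obtains z where "z \<in> carrier R" "(x \<otimes> z) \<otimes> (x \<otimes> z) \<ominus> x \<otimes> z \<in> I"
    "x [^] n \<otimes> (\<one> \<ominus> x \<otimes> z) \<in> I"
proof -
  note I' = submodule_overE[OF ideal_imp_submodule_over[OF I]]
  have pow: "x [^] n \<otimes> (\<one> \<ominus> (x \<otimes> y) [^] k) \<in> I" for k :: nat
  proof (induction k)
    case 0
    then show ?case using xy I'(2) by (simp add: minus_eq r_neg)
  next
    case (Suc k)
    define u v where uv: "u = x [^] n" "v = (x \<otimes> y) [^] k"
    then have R: "u \<in> carrier R" "v \<in> carrier R" using xy by auto
    have "u \<otimes> (\<one> \<ominus> v \<otimes> (x \<otimes> y)) = u \<otimes> (\<one> \<ominus> v) \<oplus> v \<otimes> (u \<otimes> (\<one> \<ominus> x \<otimes> y))"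
      using R xy by algebra
    also have "\<dots> \<in> I" using I'(3)[OF Suc I'(4)[OF _ reg]] R unfolding uv by simp
    finally show ?case unfolding uv by simp
  qed
  define v w where vw: "v = (x \<otimes> y) [^] n" "w = y [^] n"
  define z where "z = v \<otimes> y"
  have R: "v \<in> carrier R" "w \<in> carrier R" "z \<in> carrier R" using xy unfolding vw z_def by auto
  have "v \<otimes> (x \<otimes> y) = x \<otimes> z" unfolding z_def using R xy by algebra
  then have reg_e: "x [^] n \<otimes> (\<one> \<ominus> x \<otimes> z) \<in> I" using pow[of "Suc n"] unfolding vw by simp
  have "v = x [^] n \<otimes> w" unfolding vw using xy by (simp add: nat_pow_distrib)
  then have "(x \<otimes> z) \<otimes> (x \<otimes> z) \<ominus> x \<otimes> z = \<ominus> ((w \<otimes> (x \<otimes> y)) \<otimes> (x [^] n \<otimes> (\<one> \<ominus> x \<otimes> z)))"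
  proof -
    define u where "u = x [^] n"
    have u: "u \<in> carrier R" unfolding u_def using xy by simp
    have "x \<otimes> z = (w \<otimes> (x \<otimes> y)) \<otimes> u"
      unfolding z_def \<open>v = x [^] n \<otimes> w\<close> u_def[symmetric] using u R xy by algebra
    then show ?thesis unfolding u_def[symmetric] using u R xy by algebra
  qed
  also have "\<dots> \<in> I" using I'(5)[OF I'(4)[OF _ reg_e]] R xy by simp
  finally show ?thesis using that R(3) reg_e by blast
qed

lemma prime_contract_subset_off_conductor:
  assumes Q: "primeideal Q R" and Q': "primeideal Q' R" and "Q \<inter> T \<subseteq> Q'"
    and c: "c \<in> conductor T (carrier R)" "c \<in> carrier R" "c \<notin> Q'"
  shows "Q \<subseteq> Q'"
proof
  interpret Q: primeideal Q R by fact
  interpret Q': primeideal Q' R by fact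
  fix s assume s: "s \<in> Q"
  then have "c \<otimes> s \<in> Q" using Q.I_l_closed c(2) by blast
  moreover have "c \<otimes> s \<in> T" using c(1) Q.Icarr[OF s] unfolding conductor_def by blast
  ultimately have "c \<otimes> s \<in> Q'" using \<open>Q \<inter> T \<subseteq> Q'\<close> by blast
  then show "s \<in> Q'" using Q'.I_prime[OF c(2) Q.Icarr[OF s]] c(3) by blast
qed

lemma u_closed_obtain_idempotent:
  assumes ext: "integral_extension T R" and FCP: "FCP T R" and U: "u_closed T R" and x: "x \<in> carrier R"
  obtains n :: nat and z where "z \<in> carrier R" "x \<otimes> z \<in> T"
    "x [^] n \<otimes> (\<one> \<ominus> x \<otimes> z) \<in> conductor T (carrier R)"
proof -
  let ?C = "conductor T (carrier R)"
  have C: "ideal ?C R" using ideal_conductor_carrier[OF integral_extensionD(1)[OF ext]] .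
  obtain n :: nat and y where y: "y \<in> carrier R" "x [^] n \<otimes> (\<one> \<ominus> x \<otimes> y) \<in> ?C"
    using primes_maximal_imp_pi_regular[OF C maximalideal_if_conductor_subset[OF ext FCP] x] .
  obtain z where z: "z \<in> carrier R" "(x \<otimes> z) \<otimes> (x \<otimes> z) \<ominus> x \<otimes> z \<in> ?C"
    "x [^] n \<otimes> (\<one> \<ominus> x \<otimes> z) \<in> ?C"
    using pi_regular_imp_idempotent[OF C x y] .
  have xz: "x \<otimes> z \<in> carrier R" using x z(1) by simp
  then have "((x \<otimes> z) \<otimes> (x \<otimes> z) \<ominus> x \<otimes> z) \<otimes> (x \<otimes> z) \<in> ?C" using ideal.I_r_closed[OF C z(2)] by blast
  then have "x \<otimes> z \<in> T" using U xz z(2) conductor_subset unfolding u_closed_iff by blast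
  then show ?thesis using that z(1,3) by blast
qed

theorem u_closed_imp_spec_injective:
  assumes ext: "integral_extension T R" and FCP: "FCP T R" and U: "u_closed T R"
  shows "spec_injective T R"
proof -
  let ?C = "conductor T (carrier R)"
  have C: "ideal ?C R" using ideal_conductor_carrier[OF integral_extensionD(1)[OF ext]] .
  have "Q \<subseteq> Q'" if Q: "primeideal Q R" and Q': "primeideal Q' R" and eq: "Q \<inter> T = Q' \<inter> T" for Q Q'
  proof (cases "?C \<subseteq> Q'")
    case False
    then obtain c where c: "c \<in> ?C" "c \<notin> Q'" by blast
    show ?thesis
      using prime_contract_subset_off_conductor[OF Q Q' _ c(1) ideal.Icarr[OF C c(1)] c(2)] eq by simp
  next
    case True
    interpret Q: primeideal Q R by fact
    interpret Q': primeideal Q' R by fact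
    show ?thesis
    proof
      fix x assume x: "x \<in> Q"
      then have xR: "x \<in> carrier R" using Q.Icarr by blast
      obtain n :: nat and z where z: "z \<in> carrier R" "x \<otimes> z \<in> T" "x [^] n \<otimes> (\<one> \<ominus> x \<otimes> z) \<in> ?C"
        using u_closed_obtain_idempotent[OF ext FCP U xR] .
      have xz: "x \<otimes> z \<in> carrier R" using xR z(1) by simp
      have "x \<otimes> z \<in> Q'" using Q.I_r_closed[OF x z(1)] z(2) eq by blast
      then have "\<one> \<ominus> x \<otimes> z \<notin> Q'"
        using submodule_over_add_iff(2)[OF ideal_imp_submodule_over[OF Q'.is_ideal] _ one_closed]
          Q' unfolding primeideal_iff by blast
      then have "x [^] n \<in> Q'"
        using Q'.I_prime[OF nat_pow_closed[OF xR] minus_closed[OF one_closed xz]] z(3) True by blast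
      then show "x \<in> Q'"
        using primeideal_of_subring_nat_pow[OF carrier_is_subring _ xR, of Q' n] Q' by simp
    qed
  qed
  then show ?thesis unfolding spec_injective_def inj_on_def by blast
qed

lemma subring_adjoin_idempotent_mod:
  assumes W: "subring W R" and b: "b \<in> carrier R" and r: "b \<otimes> b \<ominus> b \<in> W"
  shows "subring (line_extension W b W) R"
proof (rule subring_line_extension[OF W W subset_refl b])
  fix k assume k: "k \<in> W"
  then have "k \<in> carrier R" using subringE(1)[OF W] by blast
  then have "k \<otimes> (b \<otimes> b) = k \<otimes> b \<oplus> k \<otimes> (b \<otimes> b \<ominus> b)" using b by algebra
  then show "k \<otimes> (b \<otimes> b) \<in> line_extension W b W"
    unfolding line_extension_mem_iff using k subringE(6)[OF W k r] by blast
qed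

lemma smult_idempotent_mod_mem:
  assumes W: "subring W R" and b: "b \<in> carrier R" and r: "b \<otimes> b \<ominus> b \<in> W"
    and w: "w \<in> W" "w \<otimes> b \<in> W"
  shows "w \<otimes> b \<otimes> b \<in> W"
proof -
  have "w \<in> carrier R" using w(1) subringE(1)[OF W] by blast
  then have "w \<otimes> b \<otimes> b = w \<otimes> b \<oplus> w \<otimes> (b \<otimes> b \<ominus> b)" using b by algebra
  then show ?thesis using subringE(7)[OF W w(2) subringE(6)[OF W w(1) r]] by simp
qed

lemma mult_line_extension_self:
  assumes W: "subring W R" and b: "b \<in> carrier R" and d: "d \<in> line_extension W b W"
  obtains k u where "k \<in> W" "u \<in> W" "b \<otimes> d = k \<otimes> b \<oplus> u \<otimes> (b \<otimes> b \<ominus> b)"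
proof -
  obtain u v where uv: "u \<in> W" "v \<in> W" "d = u \<otimes> b \<oplus> v"
    using d unfolding line_extension_mem_iff by blast
  have "u \<in> carrier R" "v \<in> carrier R" using uv subringE(1)[OF W] by auto
  then have "b \<otimes> d = (u \<oplus> v) \<otimes> b \<oplus> u \<otimes> (b \<otimes> b \<ominus> b)" unfolding uv(3) using b by algebra
  then show ?thesis using that subringE(7)[OF W uv(1,2)] uv(1) by blast
qed

lemma cgenideal_contract_subset:
  assumes ext: "integral_extension W R" and b: "b \<in> carrier R"
    and r: "b \<otimes> b \<ominus> b \<in> W" "(b \<otimes> b \<ominus> b) \<otimes> b \<in> W"
    and M: "primeideal M (R\<lparr>carrier := W\<rparr>)" and sub: "{w \<in> W. w \<otimes> b \<in> W} \<subseteq> M"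
  shows "PIdl b \<inter> W \<subseteq> M"
proof
  have W: "subring W R" using integral_extensionD(1)[OF ext] .
  note W' = subringE[OF W]
  define r where "r = b \<otimes> b \<ominus> b"
  have rW: "r \<in> W" "r \<in> carrier R" and rM: "r \<in> M" using r sub W'(1) unfolding r_def by auto
  have M_sub: "submodule_over W M"
    using M unfolding primeideal_of_subring_iff[OF W] ideal_of_subring_iff[OF W] by blast
  note M' = submodule_overE[OF M_sub]
  have wb: "w \<otimes> b \<in> M" if "w \<in> W" "w \<otimes> b \<in> W" for w
    using sub that smult_idempotent_mod_mem[OF W b r(1) that] by blast
  let ?D = "line_extension W b W"
  have D: "subring ?D R" using subring_adjoin_idempotent_mod[OF W b r(1)] .
  have WD: "W \<subseteq> ?D" by (rule line_extension_base_subset[OF W'(2,1) b])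
  have bD: "b \<in> ?D" using line_extension_smult_mem[OF W'(2,1,3) b] b by simp
  fix w assume "w \<in> PIdl b \<inter> W"
  then obtain s where w: "w \<in> W" and s: "s \<in> carrier R" "w = s \<otimes> b" unfolding cgenideal_def by blast
  have "integral_over ?D R s"
    using integral_extensionD(2)[OF integral_extension_mono[OF ext D WD] s(1)] .
  moreover have "b \<otimes> s \<ominus> w \<in> {\<zero>}" unfolding s(2) using b s(1) by (simp add: m_comm r_neg minus_eq)
  ultimately obtain n :: nat and d where d: "d \<in> ?D" "w [^] n \<oplus> b \<otimes> d \<in> {\<zero>}"
    using integral_over_scaled[OF D zeroideal bD subsetD[OF WD w] s(1)] by metis
  obtain k u where ku: "k \<in> W" "u \<in> W" "b \<otimes> d = k \<otimes> b \<oplus> u \<otimes> r"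
    using mult_line_extension_self[OF W b d(1)] unfolding r_def .
  have R: "k \<in> carrier R" "u \<in> carrier R" using ku W'(1) by auto
  have wn: "w [^] n \<in> W" "w [^] n \<in> carrier R" using subring_nat_pow_closed[OF W w] W'(1) by auto
  have sum: "w [^] n \<oplus> (k \<otimes> b \<oplus> u \<otimes> r) = \<zero>" using d(2) ku(3) by simp
  then have "k \<otimes> b \<oplus> u \<otimes> r = \<ominus> (w [^] n)"
    using R b rW(2) wn(2) by (intro minus_equality[symmetric]) (simp_all add: a_comm)
  then have "k \<otimes> b \<oplus> u \<otimes> r \<in> W" using W'(5)[OF wn(1)] by simp
  then have "k \<otimes> b \<in> W"
    using submodule_over_add_iff(1)[OF submodule_over_subring[OF W subset_refl] W'(6)[OF ku(2) rW(1)]] R b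
    by simp
  then have "k \<otimes> b \<oplus> u \<otimes> r \<in> M" using wb ku(1,2) M'(3,4) rM by blast
  then have "w [^] n \<in> M" using submodule_over_add_iff(1)[OF M_sub _ wn(2)] sum M'(2) by metis
  then show "w \<in> M" using primeideal_of_subring_nat_pow[OF W M w] by blast
qed

lemma ideal_colon:
  assumes W: "subring W R" and b: "b \<in> carrier R"
  shows "ideal {w \<in> W. w \<otimes> b \<in> W} (R\<lparr>carrier := W\<rparr>)"
  unfolding ideal_of_subring_iff[OF W]
  using subringE(1,2,6,7)[OF W] b
  by (auto intro!: submodule_overI[OF W] simp: l_distr m_assoc subset_iff)

theorem spec_injective_imp_u_closed:
  assumes ext: "integral_extension W R" and inj: "spec_injective W R"
  shows "u_closed W R"
proof -
  have W: "subring W R" using integral_extensionD(1)[OF ext] .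
  note W' = subringE[OF W]
  have "b \<in> W" if b: "b \<in> carrier R" and r: "b \<otimes> b \<ominus> b \<in> W" "(b \<otimes> b \<ominus> b) \<otimes> b \<in> W" for b
  proof (rule ccontr)
    assume "b \<notin> W"
    let ?I = "{w \<in> W. w \<otimes> b \<in> W}" and ?c = "\<one> \<ominus> b"
    have "\<one> \<notin> ?I" using b \<open>b \<notin> W\<close> by simp
    then obtain M where "maximalideal M (R\<lparr>carrier := W\<rparr>)" and IM: "?I \<subseteq> M"
      using cring.exists_maximalideal[OF subring_is_cring[OF W] ideal_colon[OF W b]] by auto
    then have M: "primeideal M (R\<lparr>carrier := W\<rparr>)"
      using cring.maximalideal_prime[OF subring_is_cring[OF W]] by blast
    have c: "?c \<in> carrier R" using b by simp
    have cr: "?c \<otimes> ?c \<ominus> ?c = b \<otimes> b \<ominus> b" "(?c \<otimes> ?c \<ominus> ?c) \<otimes> ?c = (b \<otimes> b \<ominus> b) \<ominus> (b \<otimes> b \<ominus> b) \<otimes> b"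
      using b by algebra+
    have "w \<otimes> b \<in> W" if w: "w \<in> W" "w \<otimes> ?c \<in> W" for w
    proof -
      have "w \<in> carrier R" using w(1) W'(1) by blast
      then have "w \<otimes> b = w \<ominus> w \<otimes> ?c" using b by algebra
      then show ?thesis using subring_minus_closed[OF W w] by simp
    qed
    then have "{w \<in> W. w \<otimes> ?c \<in> W} \<subseteq> ?I" by blast
    then have "PIdl ?c \<inter> W \<subseteq> M"
      using cgenideal_contract_subset[OF ext c _ _ M] cr r subring_minus_closed[OF W r] IM by auto
    then obtain Q' where Q': "primeideal Q' R" "PIdl ?c \<subseteq> Q'" "Q' \<inter> W = M"
      using lying_over_containing[OF ext cgenideal_ideal[OF c] M] by blast
    obtain Q where Q: "primeideal Q R" "PIdl b \<subseteq> Q" "Q \<inter> W = M"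
      using lying_over_containing[OF ext cgenideal_ideal[OF b] M cgenideal_contract_subset[OF ext b r M IM]] .
    have "Q = Q'" using spec_injectiveD[OF inj Q(1) Q'(1)] Q(3) Q'(3) by simp
    then have "b \<in> Q" "?c \<in> Q" using Q(2) Q'(2) cgenideal_self[OF b] cgenideal_self[OF c] by auto
    then show False
      using Q(1) submodule_over_add_iff(2)[of "carrier R" Q b \<one>]
      unfolding primeideal_iff ideal_iff_submodule_over by simp
  qed
  then show ?thesis unfolding u_closed_iff using W by blast
qed

end

section \<open>Residue fields\<close>

context domain
begin

definition fraction_rel :: "(('a \<times> 'a) \<times> ('a \<times> 'a)) set" where
  "fraction_rel = {((a, s), (b, t)). a \<in> carrier R \<and> b \<in> carrier R \<and>
     s \<in> carrier R - {\<zero>} \<and> t \<in> carrier R - {\<zero>} \<and> a \<otimes> t = b \<otimes> s}"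

lemma equiv_fraction_rel: "equiv (carrier R \<times> (carrier R - {\<zero>})) fraction_rel"
proof (rule equivI)
  show "fraction_rel \<subseteq> (carrier R \<times> (carrier R - {\<zero>})) \<times> (carrier R \<times> (carrier R - {\<zero>}))"
    "refl_on (carrier R \<times> (carrier R - {\<zero>})) fraction_rel" "sym fraction_rel"
    unfolding fraction_rel_def refl_on_def sym_def by auto
  show "trans fraction_rel"
  proof (rule transI)
    fix p q r assume pq: "(p, q) \<in> fraction_rel" and qr: "(q, r) \<in> fraction_rel"
    obtain a s b t c v where pqr: "p = (a, s)" "q = (b, t)" "r = (c, v)" by (metis surj_pair)
    have carr: "a \<in> carrier R" "b \<in> carrier R" "c \<in> carrier R" "s \<in> carrier R" "t \<in> carrier R" "v \<in> carrier R"
      and nz: "s \<noteq> \<zero>" "t \<noteq> \<zero>" "v \<noteq> \<zero>" and eq: "a \<otimes> t = b \<otimes> s" "b \<otimes> v = c \<otimes> t"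
      using pq qr unfolding fraction_rel_def pqr by auto
    have "t \<otimes> (a \<otimes> v) = (a \<otimes> t) \<otimes> v" using carr by (simp add: m_ac)
    also have "\<dots> = s \<otimes> (b \<otimes> v)" unfolding eq(1) using carr by (simp add: m_ac)
    also have "\<dots> = t \<otimes> (c \<otimes> s)" unfolding eq(2) using carr by (simp add: m_ac)
    finally have "a \<otimes> v = c \<otimes> s" using m_lcancel[OF nz(2)] carr by simp
    then show "(p, r) \<in> fraction_rel" unfolding fraction_rel_def pqr using carr nz by simp
  qed
qed

lemma fraction_relD:
  assumes "((a, s), (b, t)) \<in> fraction_rel"
  shows "a \<in> carrier R" "b \<in> carrier R" "s \<in> carrier R" "t \<in> carrier R"
    and "s \<noteq> \<zero>" "t \<noteq> \<zero>" and "a \<otimes> t = b \<otimes> s"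
  using assms unfolding fraction_rel_def by auto

lemma fraction_eq_class:
  "a \<in> carrier R \<Longrightarrow> s \<in> carrier R - {\<zero>} \<Longrightarrow> fraction R a s = fraction_rel `` {(a, s)}"
  unfolding fraction_def fraction_rel_def by auto

lemma fraction_eq_iff:
  assumes "a \<in> carrier R" "b \<in> carrier R" "s \<in> carrier R - {\<zero>}" "t \<in> carrier R - {\<zero>}"
  shows "fraction R a s = fraction R b t \<longleftrightarrow> a \<otimes> t = b \<otimes> s"
proof -
  have "fraction R a s = fraction R b t \<longleftrightarrow> ((a, s), (b, t)) \<in> fraction_rel"
    using assms eq_equiv_class_iff[OF equiv_fraction_rel, of "(a, s)" "(b, t)"] by (simp add: fraction_eq_class)
  then show ?thesis using assms unfolding fraction_rel_def by simp
qed

lemma UN_fraction: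
  assumes as: "a \<in> carrier R" "s \<in> carrier R - {\<zero>}"
    and cong: "\<And>a s b t. ((a, s), (b, t)) \<in> fraction_rel \<Longrightarrow> h a s = h b t"
  shows "(\<Union>(a', s')\<in>fraction R a s. h a' s') = h a s"
proof -
  have "case_prod h respects fraction_rel" unfolding congruent_def using cong by auto
  then show ?thesis
    using UN_equiv_class[OF equiv_fraction_rel, of "case_prod h" "(a, s)"] as by (simp add: fraction_eq_class)
qed

lemma UN_fraction2:
  assumes as: "a \<in> carrier R" "s \<in> carrier R - {\<zero>}" and bt: "b \<in> carrier R" "t \<in> carrier R - {\<zero>}"
    and cong: "\<And>a s a' s' b t b' t'. ((a, s), (a', s')) \<in> fraction_rel \<Longrightarrow> ((b, t), (b', t')) \<in> fraction_rel \<Longrightarrow>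
      h a s b t = h a' s' b' t'"
  shows "(\<Union>(a', s')\<in>fraction R a s. \<Union>(b', t')\<in>fraction R b t. h a' s' b' t') = h a s b t"
proof -
  have "congruent2 fraction_rel fraction_rel (\<lambda>p q. h (fst p) (snd p) (fst q) (snd q))"
    unfolding congruent2_def using cong by auto
  from UN_equiv_class2[OF equiv_fraction_rel equiv_fraction_rel this, of "(a, s)" "(b, t)"] show ?thesis
    using as bt by (simp add: fraction_eq_class case_prod_beta)
qed

lemma carrier_fraction_field:
  "carrier (fraction_field R) = {fraction R a s | a s. a \<in> carrier R \<and> s \<in> carrier R - {\<zero>}}"
  unfolding fraction_field_def by simp

lemma fraction_mem_carrier:
  "a \<in> carrier R \<Longrightarrow> s \<in> carrier R - {\<zero>} \<Longrightarrow> fraction R a s \<in> carrier (fraction_field R)"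
  unfolding carrier_fraction_field by blast

lemma fraction_mult:
  assumes "a \<in> carrier R" "s \<in> carrier R - {\<zero>}" "b \<in> carrier R" "t \<in> carrier R - {\<zero>}"
  shows "fraction R a s \<otimes>\<^bsub>fraction_field R\<^esub> fraction R b t = fraction R (a \<otimes> b) (s \<otimes> t)"
proof -
  have "fraction R (a \<otimes> b) (s \<otimes> t) = fraction R (a' \<otimes> b') (s' \<otimes> t')"
    if "((a, s), (a', s')) \<in> fraction_rel" "((b, t), (b', t')) \<in> fraction_rel" for a s a' s' b t b' t'
  proof -
    note as = fraction_relD[OF that(1)] and bt = fraction_relD[OF that(2)]
    note carr = as(1-4) bt(1-4) and nz = as(5,6) bt(5,6) and eq = as(7) bt(7)
    have "(a \<otimes> b) \<otimes> (s' \<otimes> t') = (a \<otimes> s') \<otimes> (b \<otimes> t')" using carr by (simp add: m_ac)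
    also have "\<dots> = (a' \<otimes> b') \<otimes> (s \<otimes> t)" unfolding eq using carr by (simp add: m_ac)
    finally show ?thesis using carr nz by (subst fraction_eq_iff) (auto simp: integral_iff)
  qed
  from UN_fraction2[OF assms this] show ?thesis unfolding fraction_field_def by simp
qed

lemma fraction_add:
  assumes "a \<in> carrier R" "s \<in> carrier R - {\<zero>}" "b \<in> carrier R" "t \<in> carrier R - {\<zero>}"
  shows "fraction R a s \<oplus>\<^bsub>fraction_field R\<^esub> fraction R b t = fraction R (a \<otimes> t \<oplus> b \<otimes> s) (s \<otimes> t)"
proof -
  have "fraction R (a \<otimes> t \<oplus> b \<otimes> s) (s \<otimes> t) = fraction R (a' \<otimes> t' \<oplus> b' \<otimes> s') (s' \<otimes> t')"
    if "((a, s), (a', s')) \<in> fraction_rel" "((b, t), (b', t')) \<in> fraction_rel" for a s a' s' b t b' t'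
  proof -
    note as = fraction_relD[OF that(1)] and bt = fraction_relD[OF that(2)]
    note carr = as(1-4) bt(1-4) and nz = as(5,6) bt(5,6) and eq = as(7) bt(7)
    have "(a \<otimes> t \<oplus> b \<otimes> s) \<otimes> (s' \<otimes> t') = (a \<otimes> s') \<otimes> (t \<otimes> t') \<oplus> (b \<otimes> t') \<otimes> (s \<otimes> s')"
      using carr by algebra
    also have "\<dots> = (a' \<otimes> t' \<oplus> b' \<otimes> s') \<otimes> (s \<otimes> t)" unfolding eq using carr by algebra
    finally show ?thesis using carr nz by (subst fraction_eq_iff) (auto simp: integral_iff)
  qed
  from UN_fraction2[OF assms this] show ?thesis unfolding fraction_field_def by simp
qed

end

definition fraction_map :: "('b, 'm) ring_scheme \<Rightarrow> ('a \<Rightarrow> 'b) \<Rightarrow> ('a \<times> 'a) set \<Rightarrow> ('b \<times> 'b) set" where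
  "fraction_map E f F = (\<Union>(a, s)\<in>F. fraction E (f a) (f s))"

locale domain_embedding = ring_hom_cring R S h + R?: domain R + S?: domain S
    for R (structure) and S (structure) and h +
  assumes inj_on_hom: "inj_on h (carrier R)"
begin

lemma hom_nonzero: "x \<in> carrier R - {\<zero>} \<Longrightarrow> h x \<in> carrier S - {\<zero>\<^bsub>S\<^esub>}"
  using inj_onD[OF inj_on_hom, of x \<zero>] by auto

lemma fraction_map_fraction:
  assumes "a \<in> carrier R" "s \<in> carrier R - {\<zero>}"
  shows "fraction_map S h (fraction R a s) = fraction S (h a) (h s)"
  unfolding fraction_map_def
proof (rule R.UN_fraction[OF assms])
  fix a s b t assume rel: "((a, s), (b, t)) \<in> R.fraction_rel"
  note rel' = R.fraction_relD[OF rel]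
  then have "h a \<otimes>\<^bsub>S\<^esub> h t = h b \<otimes>\<^bsub>S\<^esub> h s" using hom_mult[of a t] hom_mult[of b s] by simp
  then show "fraction S (h a) (h s) = fraction S (h b) (h t)"
    using rel' hom_nonzero by (subst S.fraction_eq_iff) simp_all
qed

lemma fraction_map_ring_hom: "fraction_map S h \<in> ring_hom (fraction_field R) (fraction_field S)"
proof (rule ring_hom_memI)
  fix F assume "F \<in> carrier (fraction_field R)"
  then show "fraction_map S h F \<in> carrier (fraction_field S)"
    unfolding R.carrier_fraction_field
    using fraction_map_fraction hom_nonzero hom_closed S.fraction_mem_carrier by auto
next
  show "fraction_map S h \<one>\<^bsub>fraction_field R\<^esub> = \<one>\<^bsub>fraction_field S\<^esub>"
    using fraction_map_fraction[of \<one> \<one>] unfolding fraction_field_def by simp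
next
  fix F G assume "F \<in> carrier (fraction_field R)" "G \<in> carrier (fraction_field R)"
  then obtain a s b t where FG: "F = fraction R a s" "G = fraction R b t"
    and asbt: "a \<in> carrier R" "s \<in> carrier R - {\<zero>}" "b \<in> carrier R" "t \<in> carrier R - {\<zero>}"
    unfolding R.carrier_fraction_field by blast
  have st: "s \<otimes> t \<in> carrier R - {\<zero>}" using asbt by (auto simp: R.integral_iff)
  note h = hom_closed[OF asbt(1)] hom_nonzero[OF asbt(2)] hom_closed[OF asbt(3)] hom_nonzero[OF asbt(4)]
  show "fraction_map S h (F \<otimes>\<^bsub>fraction_field R\<^esub> G) = fraction_map S h F \<otimes>\<^bsub>fraction_field S\<^esub> fraction_map S h G"
    unfolding FG R.fraction_mult[OF asbt] fraction_map_fraction[OF asbt(1,2)] fraction_map_fraction[OF asbt(3,4)]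
      S.fraction_mult[OF h]
    using asbt st by (simp add: fraction_map_fraction)
  show "fraction_map S h (F \<oplus>\<^bsub>fraction_field R\<^esub> G) = fraction_map S h F \<oplus>\<^bsub>fraction_field S\<^esub> fraction_map S h G"
    unfolding FG R.fraction_add[OF asbt] fraction_map_fraction[OF asbt(1,2)] fraction_map_fraction[OF asbt(3,4)]
      S.fraction_add[OF h]
    using asbt st by (simp add: fraction_map_fraction)
qed

lemma fraction_map_inj_on: "inj_on (fraction_map S h) (carrier (fraction_field R))"
proof (rule inj_onI)
  fix F G assume "F \<in> carrier (fraction_field R)" "G \<in> carrier (fraction_field R)"
    and eq: "fraction_map S h F = fraction_map S h G"
  then obtain a s b t where FG: "F = fraction R a s" "G = fraction R b t"
    and asbt: "a \<in> carrier R" "s \<in> carrier R - {\<zero>}" "b \<in> carrier R" "t \<in> carrier R - {\<zero>}"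
    unfolding R.carrier_fraction_field by blast
  have "h a \<otimes>\<^bsub>S\<^esub> h t = h b \<otimes>\<^bsub>S\<^esub> h s"
    using eq asbt hom_nonzero unfolding FG by (simp add: fraction_map_fraction S.fraction_eq_iff)
  then have "h (a \<otimes> t) = h (b \<otimes> s)" using asbt by simp
  then have "a \<otimes> t = b \<otimes> s" using inj_onD[OF inj_on_hom] asbt by simp
  then show "F = G" unfolding FG using asbt by (simp add: R.fraction_eq_iff)
qed

lemma fraction_map_surj_iff:
  "fraction_map S h ` carrier (fraction_field R) = carrier (fraction_field S) \<longleftrightarrow>
     (\<forall>y\<in>carrier S. \<exists>s\<in>carrier R - {\<zero>}. \<exists>a\<in>carrier R. h s \<otimes>\<^bsub>S\<^esub> y = h a)"
proof (intro iffI ballI)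
  fix y assume surj: "fraction_map S h ` carrier (fraction_field R) = carrier (fraction_field S)"
    and y: "y \<in> carrier S"
  have "fraction S y \<one>\<^bsub>S\<^esub> \<in> carrier (fraction_field S)"
    using y by (intro S.fraction_mem_carrier) simp_all
  then obtain a s where as: "a \<in> carrier R" "s \<in> carrier R - {\<zero>}" "fraction S y \<one>\<^bsub>S\<^esub> = fraction S (h a) (h s)"
    unfolding surj[symmetric] R.carrier_fraction_field using fraction_map_fraction by auto
  then have "h s \<otimes>\<^bsub>S\<^esub> y = h a"
    using y hom_nonzero[OF as(2)] by (simp add: S.fraction_eq_iff S.m_comm)
  then show "\<exists>s\<in>carrier R - {\<zero>}. \<exists>a\<in>carrier R. h s \<otimes>\<^bsub>S\<^esub> y = h a" using as(1,2) by blast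
next
  assume dense: "\<forall>y\<in>carrier S. \<exists>s\<in>carrier R - {\<zero>}. \<exists>a\<in>carrier R. h s \<otimes>\<^bsub>S\<^esub> y = h a"
  have "F \<in> fraction_map S h ` carrier (fraction_field R)" if mem: "F \<in> carrier (fraction_field S)" for F
  proof -
    obtain y z where F: "F = fraction S y z" "y \<in> carrier S" "z \<in> carrier S" "z \<noteq> \<zero>\<^bsub>S\<^esub>"
      using mem unfolding S.carrier_fraction_field by blast
    obtain s a where as: "s \<in> carrier R" "s \<noteq> \<zero>" "a \<in> carrier R" "h s \<otimes>\<^bsub>S\<^esub> y = h a" using dense F(2) by blast
    obtain t b where bt: "t \<in> carrier R" "t \<noteq> \<zero>" "b \<in> carrier R" "h t \<otimes>\<^bsub>S\<^esub> z = h b" using dense F(3) by blast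
    have hst: "h s \<noteq> \<zero>\<^bsub>S\<^esub>" "h t \<noteq> \<zero>\<^bsub>S\<^esub>" using hom_nonzero as bt by auto
    then have "h b \<noteq> \<zero>\<^bsub>S\<^esub>" unfolding bt(4)[symmetric] using F(3,4) bt(1) by (simp add: S.integral_iff)
    then have b: "b \<noteq> \<zero>" by auto
    have "y \<otimes>\<^bsub>S\<^esub> (h s \<otimes>\<^bsub>S\<^esub> h b) = (h s \<otimes>\<^bsub>S\<^esub> y) \<otimes>\<^bsub>S\<^esub> (h t \<otimes>\<^bsub>S\<^esub> z)"
      unfolding bt(4) using as(1) bt(3) F(2) by (simp add: S.m_ac)
    also have "\<dots> = (h a \<otimes>\<^bsub>S\<^esub> h t) \<otimes>\<^bsub>S\<^esub> z" unfolding as(4) using as(3) bt(1) F(3) by (simp add: S.m_assoc)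
    finally have "F = fraction S (h (a \<otimes> t)) (h (s \<otimes> b))"
      unfolding F(1) using as bt b F \<open>h b \<noteq> \<zero>\<^bsub>S\<^esub>\<close> hst by (simp add: S.fraction_eq_iff S.integral_iff)
    also have "\<dots> = fraction_map S h (fraction R (a \<otimes> t) (s \<otimes> b))"
      using as bt b by (simp add: fraction_map_fraction R.integral_iff)
    finally have "F = fraction_map S h (fraction R (a \<otimes> t) (s \<otimes> b))" .
    moreover have "fraction R (a \<otimes> t) (s \<otimes> b) \<in> carrier (fraction_field R)"
      using as bt b by (intro R.fraction_mem_carrier) (simp_all add: R.integral_iff)
    ultimately show ?thesis by (rule image_eqI)
  qed
  then show "fraction_map S h ` carrier (fraction_field R) = carrier (fraction_field S)"
    using ring_hom_closed[OF fraction_map_ring_hom] by blast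
qed

theorem fraction_map_ring_iso_iff:
  "fraction_map S h \<in> ring_iso (fraction_field R) (fraction_field S) \<longleftrightarrow>
     (\<forall>y\<in>carrier S. \<exists>s\<in>carrier R - {\<zero>}. \<exists>a\<in>carrier R. h s \<otimes>\<^bsub>S\<^esub> y = h a)"
  unfolding ring_iso_def bij_betw_def
  using fraction_map_ring_hom fraction_map_inj_on fraction_map_surj_iff by simp

end

lemma carrier_FactRing: "carrier (R Quot I) = {I +>\<^bsub>R\<^esub> x | x. x \<in> carrier R}"
  unfolding FactRing_def A_RCOSETS_def' by auto

context cring
begin

context
  fixes U Q :: "'a set"
  assumes U: "subring U R" and Q: "primeideal Q R"
begin

interpretation Q: primeideal Q R by (rule Q)

interpretation P: primeideal "Q \<inter> U" "R\<lparr>carrier := U\<rparr>" by (rule primeideal_contract[OF U Q])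

lemma quotient_map_coset:
  assumes u: "u \<in> U"
  shows "quotient_map R Q ((Q \<inter> U) +>\<^bsub>R\<lparr>carrier := U\<rparr>\<^esub> u) = Q +> u"
proof -
  have uR: "u \<in> carrier R" using u subringE(1)[OF U] by blast
  have "Q +> (q \<oplus> u) = Q +> u" if q: "q \<in> Q" for q
  proof -
    have qR: "q \<in> carrier R" using Q.Icarr[OF q] .
    then have "(q \<oplus> u) \<ominus> u = q" using uR by algebra
    then show ?thesis
      using quotient_eq_iff_same_a_r_cos[OF Q.is_ideal, of "q \<oplus> u" u] q qR uR by simp
  qed
  moreover have "Q \<inter> U \<noteq> {}"
    using additive_subgroup.zero_closed[OF Q.is_additive_subgroup] subringE(2)[OF U] by blast
  moreover have "(Q \<inter> U) +>\<^bsub>R\<lparr>carrier := U\<rparr>\<^esub> u = (\<lambda>q. q \<oplus> u) ` (Q \<inter> U)"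
    unfolding a_r_coset_def' by auto
  ultimately show ?thesis unfolding quotient_map_def by (simp add: UN_constant_eq)
qed

lemma quotient_map_ring_hom:
  "quotient_map R Q \<in> ring_hom (R\<lparr>carrier := U\<rparr> Quot (Q \<inter> U)) (R Quot Q)"
proof (rule ring_hom_memI)
  let ?D = "R\<lparr>carrier := U\<rparr> Quot (Q \<inter> U)" and ?E = "R Quot Q"
  let ?p = "\<lambda>u. (Q \<inter> U) +>\<^bsub>R\<lparr>carrier := U\<rparr>\<^esub> u"
  note U' = subringE[OF U]
  have UR: "u \<in> carrier R" if "u \<in> U" for u using that U'(1) by blast
  have mult: "?p u \<otimes>\<^bsub>?D\<^esub> ?p v = ?p (u \<otimes> v)" and add: "?p u \<oplus>\<^bsub>?D\<^esub> ?p v = ?p (u \<oplus> v)"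
    if "u \<in> U" "v \<in> U" for u v
    using ring_hom_mult[OF P.rcos_ring_hom, of u v] ring_hom_add[OF P.rcos_ring_hom, of u v] that by simp_all
  show "quotient_map R Q A \<in> carrier ?E" if "A \<in> carrier ?D" for A
    using that quotient_map_coset UR unfolding carrier_FactRing by auto
  have "\<one>\<^bsub>?D\<^esub> = ?p \<one>" unfolding FactRing_def by simp
  then show "quotient_map R Q \<one>\<^bsub>?D\<^esub> = \<one>\<^bsub>?E\<^esub>" using quotient_map_coset U'(3) by (simp add: FactRing_def)
  fix A B assume "A \<in> carrier ?D" "B \<in> carrier ?D"
  then obtain u v where uv: "u \<in> U" "v \<in> U" and AB: "A = ?p u" "B = ?p v" unfolding carrier_FactRing by auto
  show "quotient_map R Q (A \<otimes>\<^bsub>?D\<^esub> B) = quotient_map R Q A \<otimes>\<^bsub>?E\<^esub> quotient_map R Q B"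
    using uv U'(6) UR ring_hom_mult[OF Q.rcos_ring_hom] unfolding AB by (simp add: mult quotient_map_coset)
  show "quotient_map R Q (A \<oplus>\<^bsub>?D\<^esub> B) = quotient_map R Q A \<oplus>\<^bsub>?E\<^esub> quotient_map R Q B"
    using uv U'(7) UR ring_hom_add[OF Q.rcos_ring_hom] unfolding AB by (simp add: add quotient_map_coset)
qed

lemma quotient_map_inj_on: "inj_on (quotient_map R Q) (carrier (R\<lparr>carrier := U\<rparr> Quot (Q \<inter> U)))"
proof (rule inj_onI)
  let ?p = "\<lambda>u. (Q \<inter> U) +>\<^bsub>R\<lparr>carrier := U\<rparr>\<^esub> u"
  fix A B assume "A \<in> carrier (R\<lparr>carrier := U\<rparr> Quot (Q \<inter> U))" "B \<in> carrier (R\<lparr>carrier := U\<rparr> Quot (Q \<inter> U))"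
    and eq: "quotient_map R Q A = quotient_map R Q B"
  then obtain u v where uv: "u \<in> U" "v \<in> U" and AB: "A = ?p u" "B = ?p v" unfolding carrier_FactRing by auto
  have R: "u \<in> carrier R" "v \<in> carrier R" using uv subringE(1)[OF U] by auto
  have "Q +> u = Q +> v" using eq uv unfolding AB by (simp add: quotient_map_coset)
  then have "u \<ominus> v \<in> Q \<inter> U"
    using quotient_eq_iff_same_a_r_cos[OF Q.is_ideal R] subring_minus_closed[OF U uv] by blast
  moreover have "u = (u \<ominus> v) \<oplus> v" using R by algebra
  ultimately have "u \<in> ?p v" unfolding a_r_coset_def' by auto
  then show "A = B" unfolding AB using P.a_repr_independence'[of u v] uv(2) by simp
qed

lemma quotient_map_domain_embedding:
  "domain_embedding (R\<lparr>carrier := U\<rparr> Quot (Q \<inter> U)) (R Quot Q) (quotient_map R Q)"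
  using quotient_map_ring_hom quotient_map_inj_on P.quotient_is_domain Q.quotient_is_domain
  unfolding domain_embedding_def domain_embedding_axioms_def ring_hom_cring_def ring_hom_cring_axioms_def
  by (auto simp: domain_def)

end

definition same_residue_field :: "'a set \<Rightarrow> 'a set \<Rightarrow> bool" where
  "same_residue_field U Q \<longleftrightarrow> (\<forall>x\<in>carrier R. \<exists>u\<in>U - Q. \<exists>w\<in>U. u \<otimes> x \<ominus> w \<in> Q)"

theorem residue_map_ring_iso_iff:
  assumes U: "subring U R" and Q: "primeideal Q R"
  shows "residue_map R Q \<in> ring_iso (residue_field (R\<lparr>carrier := U\<rparr>) (Q \<inter> U)) (residue_field R Q) \<longleftrightarrow>
    same_residue_field U Q"
proof -
  let ?D = "R\<lparr>carrier := U\<rparr> Quot (Q \<inter> U)" and ?E = "R Quot Q"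
  let ?p = "\<lambda>u. (Q \<inter> U) +>\<^bsub>R\<lparr>carrier := U\<rparr>\<^esub> u"
  interpret Q: primeideal Q R by fact
  interpret P: primeideal "Q \<inter> U" "R\<lparr>carrier := U\<rparr>" by (rule primeideal_contract[OF U Q])
  interpret emb: domain_embedding ?D ?E "quotient_map R Q"
    by (rule quotient_map_domain_embedding[OF U Q])
  have UR: "u \<in> carrier R" if "u \<in> U" for u using that subringE(1)[OF U] by blast
  have nonzero: "?p u \<noteq> \<zero>\<^bsub>?D\<^esub> \<longleftrightarrow> u \<notin> Q" if u: "u \<in> U" for u
    using P.rcos_const_imp_mem[of u] P.a_rcos_const[of u] u unfolding FactRing_def by auto
  have mult: "quotient_map R Q (?p u) \<otimes>\<^bsub>?E\<^esub> (Q +> x) = quotient_map R Q (?p w) \<longleftrightarrow> u \<otimes> x \<ominus> w \<in> Q"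
    if "u \<in> U" "x \<in> carrier R" "w \<in> U" for u x w
    using that UR ring_hom_mult[OF Q.rcos_ring_hom, of u x]
      quotient_eq_iff_same_a_r_cos[OF Q.is_ideal, of "u \<otimes> x" w]
    by (simp add: quotient_map_coset[OF U Q])
  have "residue_map R Q = fraction_map ?E (quotient_map R Q)"
    unfolding residue_map_def fraction_map_def ..
  then have "residue_map R Q \<in> ring_iso (residue_field (R\<lparr>carrier := U\<rparr>) (Q \<inter> U)) (residue_field R Q) \<longleftrightarrow>
    (\<forall>y\<in>carrier ?E. \<exists>s\<in>carrier ?D - {\<zero>\<^bsub>?D\<^esub>}. \<exists>a\<in>carrier ?D.
       quotient_map R Q s \<otimes>\<^bsub>?E\<^esub> y = quotient_map R Q a)"
    unfolding residue_field_def using emb.fraction_map_ring_iso_iff by simp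
  also have "\<dots> \<longleftrightarrow> (\<forall>x\<in>carrier R. \<exists>u\<in>U - Q. \<exists>w\<in>U.
      quotient_map R Q (?p u) \<otimes>\<^bsub>?E\<^esub> (Q +> x) = quotient_map R Q (?p w))"
  proof -
    have "carrier ?D - {\<zero>\<^bsub>?D\<^esub>} = ?p ` (U - Q)" unfolding carrier_FactRing using nonzero by auto
    moreover have "carrier ?D = ?p ` U" "carrier ?E = (\<lambda>x. Q +> x) ` carrier R"
      unfolding carrier_FactRing by auto
    ultimately show ?thesis by simp
  qed
  also have "\<dots> \<longleftrightarrow> same_residue_field U Q"
    unfolding same_residue_field_def using mult by (intro ball_cong refl) (meson DiffD1)
  finally show ?thesis .
qed

lemma subintegral_iff:
  "subintegral U R \<longleftrightarrow> integral_extension U R \<and> spec_injective U R \<and>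
     (\<forall>Q. primeideal Q R \<longrightarrow> same_residue_field U Q)"
  unfolding subintegral_def spec_injective_def
  using residue_map_ring_iso_iff integral_extensionD(1)[of U R] by blast

lemma subintegral_carrier: "subintegral (carrier R) R"
  unfolding subintegral_iff
proof (intro conjI allI impI)
  have "integral_over (carrier R) R x" if x: "x \<in> carrier R" for x
    unfolding integral_over_def
  proof (intro exI conjI)
    show "eval [\<one>, \<ominus> x] x = \<zero>" using x by (simp add: r_neg)
  qed (use x in auto)
  then show "integral_extension (carrier R) R"
    unfolding integral_extension_def ring_extension_def using carrier_is_subring is_cring by blast
next
  have "Q \<inter> carrier R = Q" if "primeideal Q R" for Q
    using that submodule_overE(1) unfolding primeideal_iff ideal_iff_submodule_over by blast
  then show "spec_injective (carrier R) R" unfolding spec_injective_def inj_on_def by simp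
next
  fix Q assume Q: "primeideal Q R"
  then have "\<one> \<in> carrier R - Q" "\<zero> \<in> Q"
    using submodule_overE(2) unfolding primeideal_iff ideal_iff_submodule_over by blast+
  moreover from this have "\<one> \<otimes> x \<ominus> x \<in> Q" if "x \<in> carrier R" for x using that by (simp add: minus_eq r_neg)
  ultimately show "same_residue_field (carrier R) Q" unfolding same_residue_field_def by blast
qed

end

section \<open>Maximal chains and catenarian extensions\<close>

lemma chain_extends_to_maxchain:
  assumes D: "subset.chain \<A> D"
  obtains C where "subset.maxchain \<A> C" "D \<subseteq> C"
proof -
  let ?\<B> = "{Z \<in> \<A>. \<forall>Y\<in>D. Y \<subseteq> Z \<or> Z \<subseteq> Y}"
  obtain C where "subset.maxchain ?\<B> C" using subset.Hausdorff by blast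
  then have ch: "subset.chain ?\<B> C" and max: "\<And>Z. Z \<in> ?\<B> \<Longrightarrow> \<forall>Y\<in>C. Y \<subseteq> Z \<or> Z \<subseteq> Y \<Longrightarrow> Z \<in> C"
    unfolding maxchain_iff by auto
  have CB: "C \<subseteq> ?\<B>" using ch unfolding subset_chain_def by (rule conjunct1)
  have "D \<subseteq> C"
  proof
    fix Z assume Z: "Z \<in> D"
    then have "Z \<in> ?\<B>" using subset.chain_total[OF D] D unfolding subset_chain_def by blast
    moreover have "\<forall>Y\<in>C. Y \<subseteq> Z \<or> Z \<subseteq> Y" using CB Z by blast
    ultimately show "Z \<in> C" by (rule max)
  qed
  moreover have "subset.maxchain \<A> C"
    unfolding maxchain_iff
  proof (intro conjI ballI impI)
    show "subset.chain \<A> C" using ch unfolding subset_chain_def by blast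
    fix Z assume Z: "Z \<in> \<A>" "\<forall>Y\<in>C. Y \<subseteq> Z \<or> Z \<subseteq> Y"
    then have "Z \<in> ?\<B>" using \<open>D \<subseteq> C\<close> by blast
    then show "Z \<in> C" using Z(2) by (rule max)
  qed
  ultimately show ?thesis using that by blast
qed

lemma maxchain_interval_ends:
  assumes C: "subset.maxchain (\<A> \<inter> {A..B}) C" and AB: "A \<in> \<A>" "B \<in> \<A>" "A \<subseteq> B"
  shows "A \<in> C" and "B \<in> C"
proof -
  have sub: "C \<subseteq> {A..B}" and max: "\<And>Z. Z \<in> \<A> \<inter> {A..B} \<Longrightarrow> \<forall>Y\<in>C. Y \<subseteq> Z \<or> Z \<subseteq> Y \<Longrightarrow> Z \<in> C"
    using C unfolding maxchain_iff subset_chain_def by auto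
  have bounds: "A \<subseteq> Y" "Y \<subseteq> B" if "Y \<in> C" for Y using subsetD[OF sub that] by simp_all
  show "A \<in> C" "B \<in> C" by (rule max; use AB bounds in simp)+
qed

lemma maxchain_glue:
  assumes C: "subset.maxchain (\<A> \<inter> {A..B}) C" and D: "subset.maxchain (\<A> \<inter> {B..E}) D"
    and mem: "A \<in> \<A>" "B \<in> \<A>" "E \<in> \<A>" and le: "A \<subseteq> B" "B \<subseteq> E"
  shows "subset.maxchain (\<A> \<inter> {A..E}) (C \<union> D)" and "C \<inter> D = {B}"
proof -
  have B: "B \<in> C" "B \<in> D"
    using maxchain_interval_ends(2)[OF C mem(1,2) le(1)] maxchain_interval_ends(1)[OF D mem(2,3) le(2)] .
  have chC: "subset.chain (\<A> \<inter> {A..B}) C" and chD: "subset.chain (\<A> \<inter> {B..E}) D"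
    using C D unfolding maxchain_iff by auto
  then have subs: "C \<subseteq> \<A> \<inter> {A..B}" "D \<subseteq> \<A> \<inter> {B..E}" unfolding subset_chain_def by auto
  have le_B: "Y \<subseteq> B" if "Y \<in> C" for Y using subsetD[OF subs(1) that] by simp
  have ge_B: "B \<subseteq> Y" if "Y \<in> D" for Y using subsetD[OF subs(2) that] by simp
  have CD: "Y \<subseteq> Z" if "Y \<in> C" "Z \<in> D" for Y Z using le_B[OF that(1)] ge_B[OF that(2)] by (rule subset_trans)
  have "Y = B" if "Y \<in> C" "Y \<in> D" for Y using le_B[OF that(1)] ge_B[OF that(2)] by (rule subset_antisym)
  then show "C \<inter> D = {B}" using B by blast
  show "subset.maxchain (\<A> \<inter> {A..E}) (C \<union> D)"
    unfolding maxchain_iff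
  proof (intro conjI ballI impI)
    have "{A..B} \<subseteq> {A..E}" "{B..E} \<subseteq> {A..E}" using le by simp_all
    then have "C \<union> D \<subseteq> \<A> \<inter> {A..E}" using subs by blast
    moreover have "Y \<subseteq> Z \<or> Z \<subseteq> Y" if "Y \<in> C \<union> D" "Z \<in> C \<union> D" for Y Z
      using that CD[of Y Z] CD[of Z Y] subset.chain_total[OF chC, of Y Z] subset.chain_total[OF chD, of Y Z]
      by blast
    ultimately show "subset.chain (\<A> \<inter> {A..E}) (C \<union> D)" unfolding subset_chain_def by blast
  next
    fix Z assume Z: "Z \<in> \<A> \<inter> {A..E}" and comp: "\<forall>Y\<in>C \<union> D. Y \<subseteq> Z \<or> Z \<subseteq> Y"
    then consider (below) "Z \<in> \<A> \<inter> {A..B}" | (above) "Z \<in> \<A> \<inter> {B..E}" using B by auto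
    then show "Z \<in> C \<union> D"
    proof cases
      case below
      then show ?thesis using C comp unfolding maxchain_iff by blast
    next
      case above
      then show ?thesis using D comp unfolding maxchain_iff by blast
    qed
  qed
qed

lemma FCP_maxchain_finite_nonempty:
  assumes FCP: "FCP R S" and C: "subset.maxchain (intermediate_rings R S) C"
  shows "finite C" and "C \<noteq> {}"
proof -
  show "finite C" using FCP_finite_chain[OF FCP subset_refl subset.maxchain_imp_chain[OF C]] .
  have "R \<in> intermediate_rings R S"
    using FCP unfolding FCP_def ring_extension_def intermediate_rings_def by blast
  then show "C \<noteq> {}" using C unfolding maxchain_iff by blast
qed

lemma catenarian_iff_card_eq:
  "catenarian R S \<longleftrightarrow> FCP R S \<and>
     (\<forall>C D. subset.maxchain (intermediate_rings R S) C \<and> subset.maxchain (intermediate_rings R S) D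
        \<longrightarrow> card C = card D)"
proof -
  have "chain_length C = chain_length D \<longleftrightarrow> card C = card D"
    if "FCP R S" "subset.maxchain (intermediate_rings R S) C" "subset.maxchain (intermediate_rings R S) D" for C D
    using FCP_maxchain_finite_nonempty[OF that(1,2)] FCP_maxchain_finite_nonempty[OF that(1,3)]
      card_gt_0_iff[of C] card_gt_0_iff[of D]
    unfolding chain_length_def by linarith
  then show ?thesis unfolding catenarian_def by meson
qed

lemma catenarian_card_chain_le:
  assumes cat: "catenarian R S" and C: "subset.maxchain (intermediate_rings R S) C"
    and D: "subset.chain (intermediate_rings R S) D"
  shows "finite D" and "card D \<le> card C"
proof -
  have FCP: "FCP R S" using cat unfolding catenarian_def by blast
  obtain E where E: "subset.maxchain (intermediate_rings R S) E" "D \<subseteq> E"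
    using chain_extends_to_maxchain[OF D] .
  have "finite E" using FCP_maxchain_finite_nonempty(1)[OF FCP E(1)] .
  then show "finite D" "card D \<le> card C"
    using E cat C card_mono[of E D] finite_subset[of D E] unfolding catenarian_iff_card_eq by metis+
qed

theorem catenarian_intermediate:
  assumes cat: "catenarian R S" and T: "T \<in> intermediate_rings R S" and B: "B \<in> intermediate_rings R S"
    and TB: "T \<subseteq> B"
  shows "catenarian T (S\<lparr>carrier := B\<rparr>)"
proof -
  let ?\<A> = "intermediate_rings R S"
  have FCP: "FCP R S" using cat unfolding catenarian_def by blast
  then interpret cring S unfolding FCP_def ring_extension_def by blast
  have ends: "R \<in> ?\<A>" "carrier S \<in> ?\<A>" "R \<subseteq> T" "R \<subseteq> B" "B \<subseteq> carrier S"
    using FCP carrier_is_subring T B TB subringE(1)[of _ S]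
    unfolding FCP_def ring_extension_def intermediate_rings_def by blast+
  have interval: "intermediate_rings T (S\<lparr>carrier := B\<rparr>) = ?\<A> \<inter> {T..B}"
    using intermediate_rings_eq_interval[OF is_cring _ ends(3)] B unfolding intermediate_rings_def by blast
  have whole: "?\<A> = ?\<A> \<inter> {R..carrier S}"
    using intermediate_rings_eq_interval[OF is_cring carrier_is_subring subset_refl, of R] by simp
  have fin: "finite C" if "subset.maxchain (?\<A> \<inter> {Y..Z}) C" for Y Z C
    using FCP_finite_chain[OF FCP _ subset.maxchain_imp_chain[OF that]] by blast
  obtain L where L: "subset.maxchain (?\<A> \<inter> {R..T}) L" using subset.Hausdorff by blast
  obtain U where U: "subset.maxchain (?\<A> \<inter> {B..carrier S}) U" using subset.Hausdorff by blast
  have extend: "subset.maxchain ?\<A> (L \<union> C \<union> U)" "card L + card C + card U = card (L \<union> C \<union> U) + 2"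
    if C: "subset.maxchain (?\<A> \<inter> {T..B}) C" for C
  proof -
    note LC = maxchain_glue[OF L C ends(1) T B ends(3) TB]
    note LCU = maxchain_glue[OF LC(1) U ends(1) B ends(2) ends(4,5)]
    show "subset.maxchain ?\<A> (L \<union> C \<union> U)" using LCU(1) whole by simp
    show "card L + card C + card U = card (L \<union> C \<union> U) + 2"
      using card_Un_Int[OF fin[OF L] fin[OF C]] card_Un_Int[OF fin[OF LC(1)] fin[OF U]] LC(2) LCU(2) by simp
  qed
  have "card C = card D" if C: "subset.maxchain (?\<A> \<inter> {T..B}) C" and D: "subset.maxchain (?\<A> \<inter> {T..B}) D" for C D
  proof -
    have "card (L \<union> C \<union> U) = card (L \<union> D \<union> U)"
      using cat extend(1)[OF C] extend(1)[OF D] unfolding catenarian_iff_card_eq by blast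
    then show ?thesis using extend(2)[OF C] extend(2)[OF D] by linarith
  qed
  then show ?thesis
    unfolding catenarian_iff_card_eq interval using FCP_intermediate[OF FCP T B TB] by blast
qed

corollary catenarian_mono:
  assumes cat: "catenarian R S" and T: "T \<in> intermediate_rings R S"
  shows "catenarian T S"
proof -
  have "cring S" using cat unfolding catenarian_def FCP_def ring_extension_def by blast
  then interpret cring S .
  have "carrier S \<in> intermediate_rings R S"
    using T carrier_is_subring subringE(1)[of T S] unfolding intermediate_rings_def by blast
  moreover have "T \<subseteq> carrier S" using T subringE(1)[of T S] unfolding intermediate_rings_def by blast
  ultimately show ?thesis using catenarian_intermediate[OF cat T, of "carrier S"] by simp
qed

section \<open>Ramified minimal extensions\<close>

context cring
begin

lemma square_mem_conductor_if_u_closed: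
  assumes AB: "minimal_extension A B" and U: "u_closed A R"
    and Q: "ideal Q R" "Q \<inter> A = conductor A B" and x: "x \<in> B" "x \<in> Q"
  shows "x \<otimes> x \<in> conductor A B"
proof -
  note AB' = minimal_extensionD[OF AB]
  note A' = subringE[OF AB'(1)] and B' = subringE[OF AB'(2)]
  interpret Q: ideal Q R by fact
  let ?M = "conductor A B"
  have M_sub: "submodule_over B ?M" using submodule_over_conductor[OF AB'(1,2)] AB'(3) by blast
  note M' = submodule_overE[OF M_sub]
  have xR: "x \<in> carrier R" using Q.Icarr[OF x(2)] .
  have "x \<otimes> x \<in> A"
  proof (rule ccontr)
    assume sq: "x \<otimes> x \<notin> A"
    then have "line_extension B (x \<otimes> x) A = B"
      using minimal_extension_line_extension[OF AB B'(6)[OF x(1,1)] B'(3)] xR by simp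
    then obtain y a where ya: "y \<in> B" "a \<in> A" "x = y \<otimes> (x \<otimes> x) \<oplus> a"
      using x(1) line_extension_mem_iff by metis
    have R: "y \<in> carrier R" "a \<in> carrier R" using ya B'(1) A'(1) by auto
    define e where "e = y \<otimes> x"
    have e: "e \<in> B" "e \<in> carrier R" "e \<in> Q"
      unfolding e_def using B'(6)[OF ya(1) x(1)] R(1) xR Q.I_l_closed[OF x(2) R(1)] by auto
    have xe: "x = e \<otimes> x \<oplus> a" using ya(3) R xR unfolding e_def by (simp add: m_assoc)
    have "a \<oplus> e \<otimes> x \<in> Q" using x(2) xe e(2) xR R(2) by (simp add: a_comm)
    then have "a \<in> ?M"
      using submodule_over_add_iff(1)[OF ideal_imp_submodule_over[OF Q(1)] Q.I_r_closed[OF e(3) xR] R(2)]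
        ya(2) Q(2) by blast
    have "e \<otimes> e \<ominus> e = y \<otimes> (e \<otimes> x) \<ominus> y \<otimes> (e \<otimes> x \<oplus> a)"
      using xe e(2) R xR by (simp add: e_def[symmetric] m_ac)
    also have "\<dots> = \<ominus> (y \<otimes> a)" using e(2) R xR by algebra
    also have "\<dots> \<in> ?M" using M'(4)[OF ya(1) \<open>a \<in> ?M\<close>] M'(5) by blast
    finally have idem: "e \<otimes> e \<ominus> e \<in> ?M" .
    then have "(e \<otimes> e \<ominus> e) \<otimes> e \<in> ?M"
      using M'(4)[OF e(1) idem] m_comm[OF e(2), of "e \<otimes> e \<ominus> e"] e(2) by simp
    then have "e \<in> A" using U idem e(2) conductor_subset unfolding u_closed_iff by blast
    then have "e \<in> ?M" using e(3) Q(2) by blast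
    then have "x \<otimes> e \<oplus> a \<in> ?M" using M'(3)[OF M'(4)[OF x(1)] \<open>a \<in> ?M\<close>] by blast
    then have "x \<in> A" using xe e(2) xR conductor_subset by (metis m_comm subsetD)
    then show False using A'(6) sq by blast
  qed
  then show ?thesis using Q.I_l_closed[OF x(2) xR] Q(2) by blast
qed

lemma minimal_extension_maxchain_insert:
  assumes AB: "minimal_extension A B" and T: "subring T R" "T \<subseteq> A"
    and C: "subset.maxchain (intermediate_rings T (R\<lparr>carrier := A\<rparr>)) C"
  shows "subset.maxchain (intermediate_rings T (R\<lparr>carrier := B\<rparr>)) (insert B C)"
  unfolding maxchain_iff
proof (intro conjI ballI impI)
  note AB' = minimal_extensionD[OF AB]
  note mem_iff = intermediate_rings_of_subring[OF is_cring AB'(1)]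
    intermediate_rings_of_subring[OF is_cring AB'(2)]
  have ch: "subset.chain (intermediate_rings T (R\<lparr>carrier := A\<rparr>)) C"
    and max: "\<forall>Z\<in>intermediate_rings T (R\<lparr>carrier := A\<rparr>). (\<forall>Y\<in>C. Y \<subseteq> Z \<or> Z \<subseteq> Y) \<longrightarrow> Z \<in> C"
    using C unfolding maxchain_iff by auto
  have CA: "Y \<subseteq> A" if "Y \<in> C" for Y using ch that unfolding subset_chain_def mem_iff by blast
  show "subset.chain (intermediate_rings T (R\<lparr>carrier := B\<rparr>)) (insert B C)"
    unfolding subset_chain_insert
  proof (intro conjI)
    show "B \<in> intermediate_rings T (R\<lparr>carrier := B\<rparr>)" unfolding mem_iff using AB'(2,3) T(2) by blast
    show "\<forall>Y\<in>C. Y \<subseteq> B \<or> B \<subseteq> Y" using CA AB'(3) by blast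
    show "subset.chain (intermediate_rings T (R\<lparr>carrier := B\<rparr>)) C"
      using ch AB'(3) unfolding subset_chain_def mem_iff by auto
  qed
  have "A \<in> C" using max CA AB'(1) T(2) unfolding mem_iff by blast
  fix Z assume Z: "Z \<in> intermediate_rings T (R\<lparr>carrier := B\<rparr>)" and comp: "\<forall>Y\<in>insert B C. Y \<subseteq> Z \<or> Z \<subseteq> Y"
  then have Z': "subring Z R" "T \<subseteq> Z" "Z \<subseteq> B" unfolding mem_iff by auto
  have "Z \<subseteq> A \<or> A \<subseteq> Z" using comp \<open>A \<in> C\<close> by blast
  then show "Z \<in> insert B C"
  proof
    assume "Z \<subseteq> A"
    then have "Z \<in> intermediate_rings T (R\<lparr>carrier := A\<rparr>)" unfolding mem_iff using Z' by blast
    then show ?thesis using max comp by blast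
  next
    assume "A \<subseteq> Z"
    then show ?thesis using AB'(4)[OF Z'(1) _ Z'(3)] \<open>A \<in> C\<close> by blast
  qed
qed

context
  fixes A M :: "'a set" and x :: 'a
  assumes A: "subring A R" and M: "maximalideal M (R\<lparr>carrier := A\<rparr>)"
    and x: "x \<in> carrier R" "x \<notin> A" "x \<otimes> x \<in> M" and Mx: "\<And>m. m \<in> M \<Longrightarrow> m \<otimes> x \<in> M"
begin

lemma submodule_over_ramified: "submodule_over A M"
  using M unfolding maximalideal_of_subring_iff[OF A] ideal_of_subring_iff[OF A] by blast

lemma ramified_mem_if_smult_mem:
  assumes "a \<in> A" "a \<otimes> x \<in> A"
  shows "a \<in> M"
proof -
  let ?J = "{a \<in> A. a \<otimes> x \<in> A}"
  have "M \<subseteq> ?J"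
    using M Mx unfolding maximalideal_of_subring_iff[OF A] ideal_of_subring_iff[OF A] by blast
  moreover have "\<one> \<notin> ?J" using x(1,2) by simp
  ultimately have "?J = M"
    using M ideal_colon[OF A x(1)] unfolding maximalideal_of_subring_iff[OF A] by blast
  then show ?thesis using assms by blast
qed

lemma subring_ramified_line_extension:
  assumes Y: "subring Y R" "M \<subseteq> Y" "Y \<subseteq> K" and K: "subring K R" "K \<subseteq> A"
  shows "subring (line_extension K x Y) R"
proof (rule subring_line_extension[OF Y(1) K(1) Y(3) x(1)])
  fix k assume "k \<in> K"
  then have "k \<otimes> (x \<otimes> x) \<in> Y" using submodule_overE(4)[OF submodule_over_ramified _ x(3)] K(2) Y(2) by blast
  then show "k \<otimes> (x \<otimes> x) \<in> line_extension K x Y"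
    using line_extension_base_subset[OF subringE(2)[OF K(1)] subringE(1)[OF Y(1)] x(1)] by blast
qed

lemma ramified_line_extension_Int:
  assumes Y: "subring Y R" "M \<subseteq> Y" "Y \<subseteq> A"
  shows "line_extension A x Y \<inter> A = Y"
proof
  show "Y \<subseteq> line_extension A x Y \<inter> A"
    using line_extension_base_subset[OF subringE(2)[OF A] subringE(1)[OF Y(1)] x(1)] Y(3) by blast
  show "line_extension A x Y \<inter> A \<subseteq> Y"
  proof
    fix z assume "z \<in> line_extension A x Y \<inter> A"
    then have "z \<in> A" "z \<in> line_extension A x Y" by auto
    then obtain a y where z: "z = a \<otimes> x \<oplus> y" "a \<in> A" "y \<in> Y" "z \<in> A"
      unfolding line_extension_mem_iff by blast
    have "a \<otimes> x \<in> A"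
      using submodule_over_add_iff(1)[OF submodule_over_subring[OF A subset_refl], of y "a \<otimes> x"]
        z Y(3) x(1) subringE(1)[OF A] by blast
    then have "a \<otimes> x \<in> Y" using Mx[OF ramified_mem_if_smult_mem[OF z(2)]] Y(2) by blast
    then show "z \<in> Y" unfolding z(1) using subringE(7)[OF Y(1)] z(3) by blast
  qed
qed

lemma ramified_line_extension_neq:
  assumes T: "subring T R" "M \<subseteq> T" "T \<subset> A" and Y: "\<zero> \<in> Y"
  shows "line_extension A x Y \<noteq> line_extension T x T"
proof
  assume eq: "line_extension A x Y = line_extension T x T"
  have "a \<in> T" if a: "a \<in> A" for a
  proof -
    have "a \<otimes> x \<in> line_extension T x T"
      using line_extension_smult_mem[OF Y subringE(1)[OF A] a x(1)] eq by blast
    then obtain u t where ut: "u \<in> T" "t \<in> T" "a \<otimes> x = u \<otimes> x \<oplus> t"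
      unfolding line_extension_mem_iff by blast
    have R: "a \<in> carrier R" "u \<in> carrier R" "t \<in> carrier R"
      using a ut T(3) subringE(1)[OF A] by auto
    have "(a \<ominus> u) \<otimes> x = a \<otimes> x \<ominus> u \<otimes> x" using R x(1) by algebra
    also have "\<dots> = t" unfolding ut(3) using R x(1) by algebra
    finally have "(a \<ominus> u) \<otimes> x \<in> A" using ut(2) T(3) by blast
    then have "a \<ominus> u \<in> T"
      using ramified_mem_if_smult_mem subring_minus_closed[OF A a] ut(1) T(2,3) by blast
    then show ?thesis
      using submodule_over_add_iff(2)[OF submodule_over_subring[OF T(1) subset_refl] ut(1) R(1)] by blast
  qed
  then show False using T(3) by blast
qed

lemma ramified_line_extension_mem_intermediate_rings:
  assumes B: "subring B R" "A \<subseteq> B" "x \<in> B" and Y: "subring Y R" "M \<subseteq> Y" "T \<subseteq> Y" "Y \<subseteq> K"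
    and K: "subring K R" "K \<subseteq> A"
  shows "line_extension K x Y \<in> intermediate_rings T (R\<lparr>carrier := B\<rparr>)"
proof -
  have "T \<subseteq> line_extension K x Y"
    using line_extension_base_subset[OF subringE(2)[OF K(1)] subringE(1)[OF Y(1)] x(1)] Y(3) by blast
  moreover have "line_extension K x Y \<subseteq> B"
    using line_extension_subset_subring[OF B(1) _ _ B(3)] Y(4) K(2) B(2) by blast
  ultimately show ?thesis
    unfolding intermediate_rings_of_subring[OF is_cring B(1)]
    using subring_ramified_line_extension[OF Y(1,2,4) K] by blast
qed

text \<open>A chain from \<open>T\<close> to \<open>A\<close> is moved up by adjoining \<open>A x\<close> to its members; below its image there is
  room for \<open>T\<close> and \<open>T + T x\<close>.\<close>

lemma ramified_chain:
  assumes B: "subring B R" "A \<subseteq> B" "x \<in> B" and T: "subring T R" "M \<subseteq> T" "T \<subset> A"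
    and C: "subset.chain (intermediate_rings T (R\<lparr>carrier := A\<rparr>)) C" "finite C"
  obtains D where "subset.chain (intermediate_rings T (R\<lparr>carrier := B\<rparr>)) D" "card D = card C + 2"
proof -
  define up where "up = line_extension A x"
  define T' where "T' = line_extension T x T"
  have TA: "T \<subseteq> A" "T \<subseteq> B" using T(3) B(2) by auto
  have up: "up Y \<in> intermediate_rings T (R\<lparr>carrier := B\<rparr>)" "up Y \<inter> A = Y" "T' \<subseteq> up Y" "up Y \<noteq> T'"
    if "Y \<in> C" for Y
  proof -
    have Y: "subring Y R" "T \<subseteq> Y" "Y \<subseteq> A" and MY: "M \<subseteq> Y"
      using C(1) that T(2) unfolding subset_chain_def intermediate_rings_of_subring[OF is_cring A] by auto
    show "up Y \<in> intermediate_rings T (R\<lparr>carrier := B\<rparr>)"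
      unfolding up_def by (rule ramified_line_extension_mem_intermediate_rings[OF B Y(1) MY Y(2,3) A subset_refl])
    show "up Y \<inter> A = Y" unfolding up_def by (rule ramified_line_extension_Int[OF Y(1) MY Y(3)])
    show "T' \<subseteq> up Y" unfolding up_def T'_def using TA(1) Y(2) by (rule line_extension_mono)
    show "up Y \<noteq> T'" unfolding up_def T'_def by (rule ramified_line_extension_neq[OF T subringE(2)[OF Y(1)]])
  qed
  have T': "T' \<in> intermediate_rings T (R\<lparr>carrier := B\<rparr>)"
    unfolding T'_def
    by (rule ramified_line_extension_mem_intermediate_rings[OF B T(1,2) subset_refl subset_refl T(1) TA(1)])
  have "T \<subseteq> T'" using T' unfolding intermediate_rings_def by blast
  have xT': "x \<in> T'"
    using line_extension_smult_mem[OF subringE(2,1,3)[OF T(1)] x(1)] x(1) unfolding T'_def by simp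
  let ?D = "insert T (insert T' (up ` C))"
  have "up Y \<subseteq> up Z \<or> up Z \<subseteq> up Y" if "Y \<in> C" "Z \<in> C" for Y Z
    unfolding up_def using subset.chain_total[OF C(1) that] line_extension_mono[OF subset_refl] by blast
  then have "subset.chain (intermediate_rings T (R\<lparr>carrier := B\<rparr>)) (up ` C)"
    unfolding subset_chain_def using up(1) by blast
  moreover have "T \<in> intermediate_rings T (R\<lparr>carrier := B\<rparr>)"
    unfolding intermediate_rings_of_subring[OF is_cring B(1)] using T(1) TA(2) by blast
  ultimately have "subset.chain (intermediate_rings T (R\<lparr>carrier := B\<rparr>)) ?D"
    unfolding subset_chain_insert using T' \<open>T \<subseteq> T'\<close> up(3) by blast
  moreover have "card ?D = card C + 2"
  proof -
    have "inj_on up C" using up(2) by (metis inj_onI)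
    moreover have "T' \<notin> up ` C" using up(4) by blast
    moreover have "T \<notin> insert T' (up ` C)" using xT' up(3) x(2) TA(1) by blast
    ultimately show ?thesis using C(2) by (simp add: card_image)
  qed
  ultimately show ?thesis using that by blast
qed

end

theorem not_catenarian_of_ramified:
  assumes AB: "minimal_extension A B" and max: "maximalideal (conductor A B) (R\<lparr>carrier := A\<rparr>)"
    and x: "x \<in> B" "x \<notin> A" "x \<otimes> x \<in> conductor A B"
    and T: "subring T R" "conductor A B \<subseteq> T" "T \<subset> A"
  shows "\<not> catenarian T (R\<lparr>carrier := B\<rparr>)"
proof
  assume cat: "catenarian T (R\<lparr>carrier := B\<rparr>)"
  note AB' = minimal_extensionD[OF AB]
  have AB_le: "A \<subseteq> B" and TA: "T \<subseteq> A" using AB'(3) T(3) by auto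
  have BR: "B \<subseteq> carrier R" using subringE(1)[OF AB'(2)] .
  have xR: "x \<in> carrier R" using x(1) BR by blast
  have Mx: "m \<otimes> x \<in> conductor A B" if m: "m \<in> conductor A B" for m
  proof -
    have "m \<in> carrier R" using m conductor_subset AB_le BR by blast
    then have "m \<otimes> x = x \<otimes> m" using xR by (rule m_comm)
    then show ?thesis using submodule_overE(4)[OF submodule_over_conductor[OF AB'(1,2) AB_le] x(1) m] by simp
  qed
  obtain C where "subset.maxchain (intermediate_rings T (R\<lparr>carrier := A\<rparr>)) C" using subset.Hausdorff by blast
  then have chC: "subset.chain (intermediate_rings T (R\<lparr>carrier := A\<rparr>)) C"
    and C: "subset.maxchain (intermediate_rings T (R\<lparr>carrier := B\<rparr>)) (insert B C)"
    using subset.maxchain_imp_chain minimal_extension_maxchain_insert[OF AB T(1) TA] by auto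
  have fin: "finite C" using catenarian_card_chain_le(1)[OF cat C subset.maxchain_imp_chain[OF C]] by simp
  obtain D where D: "subset.chain (intermediate_rings T (R\<lparr>carrier := B\<rparr>)) D" "card D = card C + 2"
    using ramified_chain[OF AB'(1) max xR x(2,3) Mx AB'(2) AB_le x(1) T chC fin] .
  have "B \<notin> C"
    using chC AB'(3) unfolding subset_chain_def intermediate_rings_of_subring[OF is_cring AB'(1)] by blast
  then show False using catenarian_card_chain_le(2)[OF cat C D(1)] D(2) fin by simp
qed

section \<open>Intersections of subintegral subextensions\<close>

lemma spec_injective_ideal_subset:
  assumes ext: "integral_extension V R" and inj: "spec_injective V R"
    and J: "ideal J R" and Q: "primeideal Q R" and sub: "J \<inter> V \<subseteq> Q"
  shows "J \<subseteq> Q"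
proof -
  have V: "subring V R" using integral_extensionD(1)[OF ext] .
  have "J \<inter> V \<subseteq> Q \<inter> V" using sub by blast
  then obtain Q' where Q': "primeideal Q' R" "J \<subseteq> Q'" "Q' \<inter> V = Q \<inter> V"
    using lying_over_containing[OF ext J primeideal_contract[OF V Q]] by blast
  then show ?thesis using spec_injectiveD[OF inj Q'(1) Q] by blast
qed

lemma same_residue_field_maximal_iff:
  assumes ext: "integral_extension U R" and Q: "maximalideal Q R"
  shows "same_residue_field U Q \<longleftrightarrow> (\<forall>x\<in>carrier R. \<exists>w\<in>U. x \<ominus> w \<in> Q)"
proof
  have U: "subring U R" using integral_extensionD(1)[OF ext] .
  note U' = subringE[OF U]
  have Qprime: "primeideal Q R" using maximalideal_prime[OF Q] .
  interpret Q: primeideal Q R by (rule Qprime)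
  note Q' = submodule_overE[OF ideal_imp_submodule_over[OF Q.is_ideal]]
  interpret U: cring "R\<lparr>carrier := U\<rparr>" by (rule subring_is_cring[OF U])
  have max: "maximalideal (Q \<inter> U) (R\<lparr>carrier := U\<rparr>)" using maximalideal_contract_iff[OF ext Qprime] Q by blast
  show "\<forall>x\<in>carrier R. \<exists>w\<in>U. x \<ominus> w \<in> Q" if same: "same_residue_field U Q"
  proof
    fix x assume x: "x \<in> carrier R"
    obtain u w where uw: "u \<in> U" "u \<notin> Q" "w \<in> U" "u \<otimes> x \<ominus> w \<in> Q"
      using same x unfolding same_residue_field_def by blast
    obtain y q where y: "y \<in> U" "q \<in> Q" "y \<otimes> u \<oplus> q = \<one>"
      by (rule U.maximalideal_inverse_mod[OF max, of u]) (use uw(1,2) that in auto)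
    have R: "u \<in> carrier R" "w \<in> carrier R" "y \<in> carrier R" "q \<in> carrier R"
      using uw y U'(1) Q'(1) by auto
    have "x \<ominus> y \<otimes> w = (y \<otimes> u \<oplus> q) \<otimes> x \<ominus> y \<otimes> w" unfolding y(3) using x by simp
    also have "\<dots> = x \<otimes> q \<oplus> y \<otimes> (u \<otimes> x \<ominus> w)" using R x by algebra
    also have "\<dots> \<in> Q" using Q'(3)[OF Q'(4)[OF x y(2)] Q'(4)[OF R(3) uw(4)]] .
    finally show "\<exists>w\<in>U. x \<ominus> w \<in> Q" using U'(6)[OF y(1) uw(3)] by blast
  qed
  show "same_residue_field U Q" if cover: "\<forall>x\<in>carrier R. \<exists>w\<in>U. x \<ominus> w \<in> Q"
    unfolding same_residue_field_def
  proof
    fix x assume x: "x \<in> carrier R"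
    then obtain w where "w \<in> U" "\<one> \<otimes> x \<ominus> w \<in> Q" using cover by auto
    moreover have "\<one> \<in> U - Q" using U'(3) Qprime unfolding primeideal_iff by blast
    ultimately show "\<exists>u\<in>U - Q. \<exists>w\<in>U. u \<otimes> x \<ominus> w \<in> Q" by blast
  qed
qed

lemma same_residue_field_off_conductor:
  assumes Q: "ideal Q R" and c: "c \<in> conductor V (carrier R)" "c \<in> carrier R" "c \<notin> Q"
  shows "same_residue_field V Q"
  unfolding same_residue_field_def
proof
  fix x assume x: "x \<in> carrier R"
  have "c \<otimes> x \<ominus> c \<otimes> x \<in> Q"
    using submodule_overE(2)[OF ideal_imp_submodule_over[OF Q]] x c(2) by (simp add: minus_eq r_neg)
  moreover have "c \<in> V - Q" "c \<otimes> x \<in> V" using c x unfolding conductor_def by auto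
  ultimately show "\<exists>u\<in>V - Q. \<exists>w\<in>V. u \<otimes> x \<ominus> w \<in> Q" by blast
qed

lemma same_residue_field_if_ramified:
  assumes cat: "catenarian V R" and V: "V \<subseteq> A" and ext: "integral_extension V R"
    and AB: "minimal_extension A B" and max: "maximalideal (conductor A B) (R\<lparr>carrier := A\<rparr>)"
    and Q: "maximalideal Q R" "Q \<inter> A = conductor A B" and same: "same_residue_field A Q"
    and x: "x \<in> B" "x \<notin> A" "x \<otimes> x \<in> conductor A B"
  shows "same_residue_field V Q"
proof (rule ccontr)
  assume "\<not> same_residue_field V Q"
  then obtain s where s: "s \<in> carrier R" "\<And>v. v \<in> V \<Longrightarrow> s \<ominus> v \<notin> Q"
    unfolding same_residue_field_maximal_iff[OF ext Q(1)] by blast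
  note AB' = minimal_extensionD[OF AB]
  note A' = subringE[OF AB'(1)]
  have Vs: "subring V R" using integral_extensionD(1)[OF ext] .
  interpret Q: maximalideal Q R by (rule Q(1))
  note Q' = submodule_overE[OF ideal_imp_submodule_over[OF Q.is_ideal]]
  have extA: "integral_extension A R" using integral_extension_mono[OF ext AB'(1) V] .
  have M: "ideal (conductor A B) (R\<lparr>carrier := A\<rparr>)"
    using max unfolding maximalideal_of_subring_iff[OF AB'(1)] by blast
  define T where "T = conductor A B <+>\<^bsub>R\<^esub> V"
  have T: "subring T R" "conductor A B \<subseteq> T" "V \<subseteq> T" "T \<subseteq> A"
    unfolding T_def by (rule subring_set_add_ideal[OF AB'(1) M Vs V])+
  have "T \<noteq> A"
  proof
    assume "T = A"
    obtain a where a: "a \<in> A" "s \<ominus> a \<in> Q"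
      using same s(1) unfolding same_residue_field_maximal_iff[OF extA Q(1)] by blast
    then obtain m v where mv: "m \<in> conductor A B" "v \<in> V" "a = m \<oplus> v"
      using \<open>T = A\<close> mem_set_add_iff unfolding T_def by blast
    have R: "m \<in> carrier R" "v \<in> carrier R" using subsetD[OF conductor_subset mv(1)] mv(2) V A'(1) by auto
    have "s \<ominus> v = (s \<ominus> a) \<oplus> m" unfolding mv(3) using R s(1) by algebra
    also have "\<dots> \<in> Q" using Q'(3)[OF a(2)] mv(1) Q(2) by blast
    finally show False using s(2) mv(2) by blast
  qed
  then have TA: "T \<subset> A" using T(4) by blast
  have "catenarian T (R\<lparr>carrier := B\<rparr>)"
    using catenarian_intermediate[OF cat, of T B] T(1,3) TA AB'(2,3) unfolding intermediate_rings_def by blast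
  then show False using not_catenarian_of_ramified[OF AB max x T(1,2) TA] by blast
qed

lemma same_residue_field_descend:
  assumes ext: "integral_extension V R" and inj: "spec_injective V R" and cat: "catenarian V R"
    and W: "subring W R" "V \<subseteq> W" and Q: "primeideal Q R"
    and same: "same_residue_field W Q" and cond: "conductor W (carrier R) \<inter> V \<subseteq> Q"
  shows "same_residue_field V Q"
proof -
  have extW: "integral_extension W R" using integral_extension_mono[OF ext W] .
  have FCP: "FCP W R" using cat FCP_mono[of V R W] W unfolding catenarian_def intermediate_rings_def by blast
  have "conductor W (carrier R) \<subseteq> Q \<inter> W"
    using spec_injective_ideal_subset[OF ext inj ideal_conductor_carrier[OF W(1)] Q cond] conductor_subset
    by blast
  then obtain A B Q' where AB: "minimal_extension A B" and WA: "W \<subseteq> A"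
    and Q': "maximalideal Q' R" "Q' \<inter> W = Q \<inter> W" "Q' \<inter> A = conductor A B"
    using exists_critical_minimal_extension[OF extW FCP primeideal_contract[OF W(1) Q]] by blast
  have "Q' \<inter> V = Q \<inter> V" using Q'(2) W(2) by blast
  then have "Q' = Q" using spec_injectiveD[OF inj maximalideal_prime[OF Q'(1)] Q] by blast
  then have Qmax: "maximalideal Q R" and QA: "Q \<inter> A = conductor A B" using Q' by auto
  note AB' = minimal_extensionD[OF AB]
  have VA: "V \<subseteq> A" using W(2) WA by blast
  have extA: "integral_extension A R" using integral_extension_mono[OF ext AB'(1) VA] .
  have max: "maximalideal (conductor A B) (R\<lparr>carrier := A\<rparr>)"
    using maximalideal_contract_iff[OF extA Q] Qmax QA by simp
  have sameA: "same_residue_field A Q"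
    using same WA
    unfolding same_residue_field_maximal_iff[OF extW Qmax] same_residue_field_maximal_iff[OF extA Qmax]
    by blast
  obtain b where b: "b \<in> B" "b \<notin> A" using AB'(3) by blast
  have bR: "b \<in> carrier R" using b(1) subringE(1)[OF AB'(2)] by blast
  obtain a where a: "a \<in> A" "b \<ominus> a \<in> Q"
    using sameA bR unfolding same_residue_field_maximal_iff[OF extA Qmax] by blast
  have x: "b \<ominus> a \<in> B" "b \<ominus> a \<notin> A"
    using subring_minus_closed[OF AB'(2) b(1)] a(1) AB'(3)
      submodule_over_add_iff(2)[OF submodule_over_subring[OF AB'(1) subset_refl] a(1) bR] b(2) by auto
  have "u_closed A R" using spec_injective_imp_u_closed[OF extA spec_injective_mono[OF inj VA]] .
  then have "(b \<ominus> a) \<otimes> (b \<ominus> a) \<in> conductor A B"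
    using square_mem_conductor_if_u_closed[OF AB _ _ QA x(1) a(2)] Q unfolding primeideal_iff by blast
  then show ?thesis using same_residue_field_if_ramified[OF cat VA ext AB max Qmax QA sameA x] by blast
qed

theorem subintegral_Int:
  assumes ext: "integral_extension (W1 \<inter> W2) R" and U: "u_closed (W1 \<inter> W2) R"
    and cat: "catenarian (W1 \<inter> W2) R" and W1: "subintegral W1 R" and W2: "subintegral W2 R"
  shows "subintegral (W1 \<inter> W2) R"
proof -
  let ?V = "W1 \<inter> W2"
  have FCP: "FCP ?V R" using cat unfolding catenarian_def by blast
  have inj: "spec_injective ?V R" using u_closed_imp_spec_injective[OF ext FCP U] .
  have V: "subring ?V R" and W: "subring W1 R" "subring W2 R"
    using integral_extensionD(1) ext W1 W2 unfolding subintegral_def by blast+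
  have "same_residue_field ?V Q" if Q: "primeideal Q R" for Q
  proof (cases "conductor ?V (carrier R) \<subseteq> Q")
    case False
    then obtain c where c: "c \<in> conductor ?V (carrier R)" "c \<notin> Q" by blast
    have "c \<in> carrier R" using c(1) conductor_subset subringE(1)[OF V] by blast
    then show ?thesis using same_residue_field_off_conductor[OF _ c(1) _ c(2)] Q unfolding primeideal_iff by blast
  next
    case True
    have "conductor W1 (carrier R) \<inter> ?V \<subseteq> Q \<or> conductor W2 (carrier R) \<inter> ?V \<subseteq> Q"
    proof (rule ccontr)
      assume "\<not> ?thesis"
      then obtain a b where a: "a \<in> conductor W1 (carrier R)" "a \<in> ?V" "a \<notin> Q"
        and b: "b \<in> conductor W2 (carrier R)" "b \<in> ?V" "b \<notin> Q" by blast
      then have "a \<otimes> b \<in> Q" using conductor_mult_Int[OF W subset_refl] True by blast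
      moreover have "a \<in> carrier R" "b \<in> carrier R" using a(2) b(2) subringE(1)[OF V] by auto
      ultimately show False using a(3) b(3) Q unfolding primeideal_iff by blast
    qed
    then show ?thesis
      using same_residue_field_descend[OF ext inj cat W(1) _ Q] same_residue_field_descend[OF ext inj cat W(2) _ Q]
        W1 W2 Q unfolding subintegral_iff by blast
  qed
  then show ?thesis unfolding subintegral_iff using ext inj by blast
qed

theorem exists_co_subintegral_closure:
  assumes ext: "integral_extension T R" and FCP: "FCP T R" and cat: "catenarian (u_closure T R) R"
  shows "\<exists>V. is_co_subintegral_closure T R V"
proof -
  let ?\<A> = "{W \<in> intermediate_rings T R. subintegral W R}"
  have T: "ring_extension T R" "subring T R" using ext unfolding integral_extension_def ring_extension_def by auto
  have Int: "V \<inter> W \<in> ?\<A>" if V: "V \<in> ?\<A>" and W: "W \<in> ?\<A>" for V W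
  proof -
    have u: "u_closed V R" "u_closed W R"
      using V W spec_injective_imp_u_closed unfolding subintegral_iff by blast+
    have VW: "subring (V \<inter> W) R" "T \<subseteq> V \<inter> W" using V W subring_inter unfolding intermediate_rings_def by auto
    have uVW: "u_closed (V \<inter> W) R" using u VW(1) unfolding u_closed_iff by blast
    moreover have "V \<inter> W \<in> intermediate_rings (u_closure T R) R"
      using u_closure_eq_Inter(1)[OF T(1)] VW uVW unfolding intermediate_rings_def by blast
    ultimately have "subintegral (V \<inter> W) R"
      using subintegral_Int[OF integral_extension_mono[OF ext VW] _ catenarian_mono[OF cat]] V W by blast
    then show ?thesis using VW unfolding intermediate_rings_def by blast
  qed
  have "carrier R \<in> ?\<A>"
    using subintegral_carrier carrier_is_subring subringE(1)[OF T(2)] unfolding intermediate_rings_def by blast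
  then have "\<exists>V\<in>?\<A>. \<forall>W\<in>?\<A>. W \<subseteq> V \<longrightarrow> W = V" by (intro FCP_exists_minimal[OF FCP]) auto
  then obtain V where V: "V \<in> ?\<A>" and min: "\<forall>W\<in>?\<A>. W \<subseteq> V \<longrightarrow> W = V" by (rule bexE)
  have "V \<subseteq> W" if "W \<in> ?\<A>" for W using min Int[OF V that] by blast
  then show ?thesis using V unfolding is_co_subintegral_closure_def by blast
qed

end

theorem corollary6p16:
  fixes S :: "('a, 'b) ring_scheme" and R :: "'a set"
  assumes "cring S" and "subring R S" and "R \<subset> carrier S"
    and "integral_extension R S" and "FCP R S"
  shows "(catenarian (u_closure R S) S \<longrightarrow> (\<exists>V. is_co_subintegral_closure R S V)) \<and>
         (catenarian R S \<longrightarrow>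
            catenarian (u_closure R S) S \<and> (\<exists>V. is_co_subintegral_closure R S V))"
proof -
  interpret cring S by fact
  have "ring_extension R S" using assms(1,2) unfolding ring_extension_def by blast
  then have "u_closure R S \<in> intermediate_rings R S" by (rule u_closure_eq_Inter(2))
  then have "catenarian (u_closure R S) S" if "catenarian R S" using catenarian_mono[OF that] by blast
  then show ?thesis using exists_co_subintegral_closure[OF assms(4,5)] by blast
qed

end
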